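(* Let $K$ be a field and let $\mathcal L=\{L_1,\dots,L_s\}\subset\mathbb P^3_K$, $s\ge4$, be a set of skew lines. Assume there is a transversal $T$ of multiplicity 2 for $\mathcal L$. Then $G_{\mathcal L}$ is (isomorphic to) a subgroup of the additive group $\overline K$, hence abelian. In addition, $T\cap(L_1\cup\cdots\cup L_s)$ is the only orbit with $s$ elements; indeed, for $p,q\in(\bigcup_iL_i)\setminus T$, the group $G_{\mathcal L}$ acts faithfully on each line, so we have $s|G_{\mathcal L}|=|[p]|=|[q]|>s$, and in fact $[p]$ and $[q]$ are projectively equivalent. Moreover, for $p\in(\bigcup_iL_i)\setminus T$, $[p]$ is infinite if and only if $\mathrm{char}(K)=0$.
   Context: For distinct $i,j,k$ let $f_{ijk}\colon L_i\to L_j$ be the linear isomorphism sending $p\in L_i$ to the point where the plane spanned by $p$ and $L_k$ meets $L_j$. The groupoid $C_{\mathcal L}$ has the lines $L_i$ as objects and all possible compositions of the maps $f_{ijk}$ as arrows. The groups $G_i=\mathrm{Hom}_{C_{\mathcal L}}(L_i,L_i)$ are all isomorphic, and $G_{\mathcal L}$ denotes any of them. The groupoid is canonically unchanged by field extension; if $T$ is not defined over $K$, points and orbits are to be taken over $\overline K$. For $p\in L_i$, its orbit is $[p]=\bigcup_j\{g(p):g\in\mathrm{Hom}_{C_{\mathcal L}}(L_i,L_j)\}$. A transversal for $\mathcal L$ is a line meeting every line of $\mathcal L$. Three skew lines $L_i,L_j,L_k$ lie on a unique smooth quadric $Q_{ijk}$. A line $T$ (possibly defined only over $\overline K$) is a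 transversal of multiplicity 2 for $\mathcal L$ if $T$ is a transversal for $\mathcal L$, no single smooth quadric contains all of the lines of $\mathcal L$, and for some three distinct indices $i_1,i_2,i_3$ each line $L_i\in\mathcal L$ is either contained in $Q_{i_1i_2i_3}$ or tangent to $Q_{i_1i_2i_3}$ at the point $L_i\cap T$. (This does not depend on the choice of the three indices.) Projective equivalence is by linear automorphisms of $\mathbb P^3$. *)

theory Defs
  imports
    "HOL-Analysis.Analysis"
    "HOL-Library.Equipollence"
    "HOL-Algebra.Group_Action"
    "HOL-Algebra.Algebraic_Closure_Type"
begin

text \<open>
  Projective 3-space over a field is the set of lines through the origin of the 4-dimensional
  coordinate space: a point is a 1-dimensional and a projective line a 2-dimensional subspace.
\<close>

definition proj_points :: "('a::field ^ 4) set \<Rightarrow> ('a ^ 4) set set" where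
  "proj_points V = {p. vec.subspace p \<and> vec.dim p = 1 \<and> p \<subseteq> V}"

definition proj_line :: "('a::field ^ 4) set \<Rightarrow> bool" where
  "proj_line V \<longleftrightarrow> vec.subspace V \<and> vec.dim V = 2"

definition skew_lines :: "nat \<Rightarrow> (nat \<Rightarrow> ('a::field ^ 4) set) \<Rightarrow> bool" where
  "skew_lines s L \<longleftrightarrow>
     (\<forall>i<s. proj_line (L i)) \<and>
     (\<forall>i<s. \<forall>j<s. i \<noteq> j \<longrightarrow> proj_points (L i) \<inter> proj_points (L j) = {})"

definition config_points :: "nat \<Rightarrow> (nat \<Rightarrow> ('a::field ^ 4) set) \<Rightarrow> ('a ^ 4) set set" where
  "config_points s L = (\<Union>i<s. proj_points (L i))"

definition extend_scalars :: "('a::field ^ 4) set \<Rightarrow> ('a alg_closure ^ 4) set" where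
  "extend_scalars V = vec.span ((\<lambda>x. \<chi> i. to_ac (x $ i)) ` V)"

definition projectively_equivalent :: "('a::field ^ 4) set set \<Rightarrow> ('a ^ 4) set set \<Rightarrow> bool" where
  "projectively_equivalent S S' \<longleftrightarrow>
     (\<exists>M :: 'a ^ 4 ^ 4. invertible M \<and> (\<lambda>p. (\<lambda>x. M *v x) ` p) ` S = S')"


subsection \<open>The groupoid of a set of skew lines\<close>

text \<open>
  The map \<open>L\<^sub>i \<rightarrow> L\<^sub>j\<close> along \<open>L\<^sub>k\<close>. Maps between lines are treated as maps on points,
  and are extensional (equal to \<open>undefined\<close> off the points of the source) so that equality of
  functions is equality of arrows. A projective line has at least three points over any field,
  so a linear isomorphism of projective lines is determined by its map on points.
\<close>

definition line_map ::
    "(nat \<Rightarrow> ('a::field ^ 4) set) \<Rightarrow> nat \<Rightarrow> nat \<Rightarrow> nat \<Rightarrow> ('a ^ 4) set \<Rightarrow> ('a ^ 4) set" where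
  "line_map L i j k = (\<lambda>p \<in> proj_points (L i). vec.span (p \<union> L k) \<inter> L j)"

text \<open>
  The set of arrows from \<open>L\<^sub>i\<close> to \<open>L\<^sub>j\<close>. Closure under inverses is automatic, because the
  inverse of \<open>line_map L i j k\<close> is \<open>line_map L j i k\<close>.
\<close>

inductive_set arrows ::
    "nat \<Rightarrow> (nat \<Rightarrow> ('a::field ^ 4) set) \<Rightarrow> (nat \<times> nat \<times> (('a ^ 4) set \<Rightarrow> ('a ^ 4) set)) set"
  for s :: nat and L :: "nat \<Rightarrow> ('a ^ 4) set" where
  ident: "i < s \<Longrightarrow> (i, i, \<lambda>p \<in> proj_points (L i). p) \<in> arrows s L"
| comp: "\<lbrakk>(i, j, g) \<in> arrows s L; k < s; l < s; k \<noteq> j; l \<noteq> j; l \<noteq> k\<rbrakk>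
    \<Longrightarrow> (i, k, compose (proj_points (L i)) (line_map L j k l) g) \<in> arrows s L"

definition groupoid_hom ::
    "nat \<Rightarrow> (nat \<Rightarrow> ('a::field ^ 4) set) \<Rightarrow> nat \<Rightarrow> nat \<Rightarrow> (('a ^ 4) set \<Rightarrow> ('a ^ 4) set) set" where
  "groupoid_hom s L i j = {g. (i, j, g) \<in> arrows s L}"

definition line_group ::
    "nat \<Rightarrow> (nat \<Rightarrow> ('a::field ^ 4) set) \<Rightarrow> nat \<Rightarrow> (('a ^ 4) set \<Rightarrow> ('a ^ 4) set) monoid" where
  "line_group s L i = (BijGroup (proj_points (L i)))\<lparr>carrier := groupoid_hom s L i i\<rparr>"

text \<open>
  The action of \<open>line_group s L i\<close> on the points of \<open>L\<^sub>j\<close>, obtained by transporting it along an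
  arrow \<open>h\<close> from \<open>L\<^sub>i\<close> to \<open>L\<^sub>j\<close>.
\<close>

definition line_action ::
    "(nat \<Rightarrow> ('a::field ^ 4) set) \<Rightarrow> nat \<Rightarrow> nat \<Rightarrow> (('a ^ 4) set \<Rightarrow> ('a ^ 4) set) \<Rightarrow>
     (('a ^ 4) set \<Rightarrow> ('a ^ 4) set) \<Rightarrow> ('a ^ 4) set \<Rightarrow> ('a ^ 4) set" where
  "line_action L i j h g = (\<lambda>p \<in> proj_points (L j). h (g (inv_into (proj_points (L i)) h p)))"

definition groupoid_orbit ::
    "nat \<Rightarrow> (nat \<Rightarrow> ('a::field ^ 4) set) \<Rightarrow> ('a ^ 4) set \<Rightarrow> ('a ^ 4) set set" where
  "groupoid_orbit s L p =
     {g p | i j g. i < s \<and> j < s \<and> p \<in> proj_points (L i) \<and> g \<in> groupoid_hom s L i j}"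


subsection \<open>Quadrics and transversals of multiplicity 2\<close>

text \<open>
  A quadric is given by the coefficients of a quadratic form. The matrix need not be symmetric,
  so that all quadratic forms are covered in characteristic 2 as well.
\<close>

definition quad_form :: "'a::field ^ 4 ^ 4 \<Rightarrow> 'a ^ 4 \<Rightarrow> 'a" where
  "quad_form A x = (\<Sum>i\<in>UNIV. \<Sum>j\<in>UNIV. A $ i $ j * x $ i * x $ j)"

text \<open>The vector of formal partial derivatives of \<open>quad_form A\<close> at \<open>x\<close>.\<close>

definition quad_gradient :: "'a::field ^ 4 ^ 4 \<Rightarrow> 'a ^ 4 \<Rightarrow> 'a ^ 4" where
  "quad_gradient A x = (\<chi> k. \<Sum>j\<in>UNIV. (A $ k $ j + A $ j $ k) * x $ j)"

definition quadric :: "'a::field ^ 4 ^ 4 \<Rightarrow> ('a ^ 4) set" where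
  "quadric A = {x. quad_form A x = 0}"

text \<open>The Jacobian criterion; the field has to be algebraically closed for this to be smoothness.\<close>

definition smooth_quadric :: "'a::alg_closed_field ^ 4 ^ 4 \<Rightarrow> bool" where
  "smooth_quadric A \<longleftrightarrow> (\<forall>x \<in> quadric A. x \<noteq> 0 \<longrightarrow> quad_gradient A x \<noteq> 0)"

text \<open>
  \<open>V\<close> is tangent at the point \<open>P\<close> to the quadric: \<open>V\<close> passes through \<open>P\<close>, which lies on the
  quadric, and \<open>V\<close> is contained in the tangent plane at \<open>P\<close>.
\<close>

definition tangent_at :: "'a::field ^ 4 ^ 4 \<Rightarrow> ('a ^ 4) set \<Rightarrow> ('a ^ 4) set \<Rightarrow> bool" where
  "tangent_at A V P \<longleftrightarrow> P \<in> proj_points V \<and> P \<subseteq> quadric A \<and>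
     (\<forall>x\<in>P. \<forall>y\<in>V. (\<Sum>k\<in>UNIV. quad_gradient A x $ k * y $ k) = 0)"

definition transversal :: "nat \<Rightarrow> (nat \<Rightarrow> ('a::field ^ 4) set) \<Rightarrow> ('a ^ 4) set \<Rightarrow> bool" where
  "transversal s L T \<longleftrightarrow>
     proj_line T \<and> (\<forall>i<s. proj_points (L i) \<inter> proj_points T \<noteq> {})"

text \<open>
  Three skew lines lie on exactly one smooth quadric, so the \<open>A\<close> in the last conjunct defines
  the quadric through \<open>L\<^sub>a\<close>, \<open>L\<^sub>b\<close>, \<open>L\<^sub>c\<close> and is unique up to the choice of its equation.
\<close>

definition double_transversal ::
    "nat \<Rightarrow> (nat \<Rightarrow> ('a::alg_closed_field ^ 4) set) \<Rightarrow> ('a ^ 4) set \<Rightarrow> bool" where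
  "double_transversal s L T \<longleftrightarrow>
     transversal s L T \<and>
     \<not> (\<exists>A. smooth_quadric A \<and> (\<forall>i<s. L i \<subseteq> quadric A)) \<and>
     (\<exists>a<s. \<exists>b<s. \<exists>c<s. a \<noteq> b \<and> a \<noteq> c \<and> b \<noteq> c \<and>
        (\<exists>A. smooth_quadric A \<and> L a \<subseteq> quadric A \<and> L b \<subseteq> quadric A \<and> L c \<subseteq> quadric A \<and>
           (\<forall>i<s. L i \<subseteq> quadric A \<or> tangent_at A (L i) (L i \<inter> T))))"

end

(*
  In coordinates (x1, x2, x3, x4) in which T is x3 = x4 = 0 and the tangent planes of the quadric
  along T are x4 = t x3, the lines are L_i: x4 = t_i x3, x2 = t_i x1 + u_i x3, with distinct t_i.
  Then z = x1 / x3 is an affine coordinate on every L_i, infinite exactly at the point on T, and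
  f_ijk is the translation of z by (t_i - t_j) u[t_i, t_j, t_k], a second divided difference.
  Hence the groups are finitely generated groups of translations, acting freely off T. They are
  nontrivial because otherwise u would be a quadratic polynomial in t, and then all the lines would
  lie on one smooth quadric. The map x |-> (x1 + d x3, x2 + d x4, x3, x4) translates z by d on all
  lines at once, so it carries one orbit to another. For points over a subfield the same coordinate
  is used, with values in the algebraic closure.
*)
theory Submission
  imports Defs
begin

text \<open>An arrow is determined by the amount by which it translates, because each line has at
  most one point on T. Identities between arrows thus become identities in an additive group, and
  the group and orbit statements follow from a few axioms about a single step. These axioms allow
  points over one field and coordinate values in a larger one, so that one argument serves K and its
  closure. The delicate point is projective equivalence over the smaller field: the shear is written
  in coordinates defined over the closure only, but its matrix must have entries in the smaller
  field. It does, because its effect on a line is fixed by rational points: two points whose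
  coordinates differ by d, and the point on T. In characteristic 2 a symmetric matrix does not
  describe a quadratic form. The quadric is therefore used only through its values and its polar
  form q(x+y) - q(x) - q(y), without dividing by 2.\<close>

no_notation fps_nth (infixl \<open>$\<close> 75)

section \<open>Lines in projective space\<close>

lemma vec4_eqI:
  fixes x y :: "'a ^ 4"
  shows "\<lbrakk>x $ 1 = y $ 1; x $ 2 = y $ 2; x $ 3 = y $ 3; x $ 4 = y $ 4\<rbrakk> \<Longrightarrow> x = y"
  by (simp add: vec_eq_iff forall_4)

lemma proj_points_span:
  fixes V :: "('a::field ^ 4) set"
  assumes "vec.subspace V" "x \<in> V" "x \<noteq> 0"
  shows "vec.span {x} \<in> proj_points V"
  using assms vec.span_minimal[of "{x}" V]
  by (simp add: proj_points_def)

lemma proj_pointsE: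
  fixes V :: "('a::field ^ 4) set"
  assumes "p \<in> proj_points V"
  obtains x where "x \<noteq> 0" "x \<in> V" "p = vec.span {x}"
proof -
  have p: "vec.subspace p" "vec.dim p = 1" "p \<subseteq> V" using assms by (auto simp: proj_points_def)
  have "\<not> p \<subseteq> {0}"
  proof
    assume "p \<subseteq> {0}"
    then have "vec.dim p \<le> vec.dim {0 :: 'a ^ 4}" by (rule vec.dim_subset)
    then show False using p by simp
  qed
  then obtain x where x: "x \<in> p" "x \<noteq> 0" by auto
  have "vec.span {x} = p"
    using x p vec.span_minimal[of "{x}" p] by (intro vec.subspace_dim_equal) auto
  then show thesis using that x p by blast
qed

lemma span_singleton_eqI:
  fixes x y :: "'a::field ^ 4"
  assumes "x = k *s y" "x \<noteq> 0"
  shows "vec.span {x} = vec.span {y}"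
proof -
  have "k \<noteq> 0" using assms by auto
  then have "y = inverse k *s x" using assms by (simp add: vector_smult_assoc)
  then show ?thesis
    using assms(1) vec.span_scale[OF vec.span_base, of y "{y}" k] vec.span_scale[OF vec.span_base, of x "{x}" "inverse k"]
    by (intro equalityI vec.span_minimal) auto
qed

lemma proj_points_Int_empty_iff:
  fixes V W :: "('a::field ^ 4) set"
  assumes "vec.subspace V" "vec.subspace W"
  shows "proj_points V \<inter> proj_points W = {} \<longleftrightarrow> V \<inter> W \<subseteq> {0}"
proof
  assume "proj_points V \<inter> proj_points W = {}"
  then show "V \<inter> W \<subseteq> {0}" using assms proj_points_span by blast
next
  assume *: "V \<inter> W \<subseteq> {0}"
  show "proj_points V \<inter> proj_points W = {}"
  proof (rule ccontr)
    assume "proj_points V \<inter> proj_points W \<noteq> {}"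
    then obtain p where p: "p \<in> proj_points V" "p \<subseteq> W" by (auto simp: proj_points_def)
    obtain x where "x \<noteq> 0" "x \<in> V" "p = vec.span {x}" using proj_pointsE[OF p(1)] .
    then show False using * p(2) vec.span_base[of x "{x}"] by auto
  qed
qed

text \<open>Dimension formula, 2 + 2 - 0 = 4. This is how a point of a third line is split when it
  is projected from one line to another.\<close>

lemma complementary_lines_sum:
  fixes V W :: "('a::field ^ 4) set"
  assumes "proj_line V" "proj_line W" "V \<inter> W \<subseteq> {0}"
  obtains y w where "y \<in> V" "w \<in> W" "x = y + w"
proof -
  have V: "vec.subspace V" "vec.dim V = 2" and W: "vec.subspace W" "vec.dim W = 2"
    using assms by (auto simp: proj_line_def)
  have "V \<inter> W = {0}" using assms(3) V W vec.subspace_0 by auto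
  then have "vec.dim {y + w | y w. y \<in> V \<and> w \<in> W} = 4"
    using vec.dim_sums_Int[OF V(1) W(1)] V W by simp
  then have "{y + w | y w. y \<in> V \<and> w \<in> W} = UNIV"
    by (intro vec.subspace_dim_equal vec.subspace_sums V W) (simp_all add: card_cart_basis)
  then show thesis using that by blast
qed

lemma proj_line_combination:
  fixes V :: "('a::field ^ 4) set"
  assumes "proj_line V" "x \<in> V" "y \<in> V" "y \<noteq> 0" "\<And>k. x \<noteq> k *s y" "v \<in> V"
  obtains k m where "v = k *s x + m *s y"
proof -
  have V: "vec.subspace V" "vec.dim V = 2" using assms by (auto simp: proj_line_def)
  have "vec.dim {x, y} = 2"
    using assms(4,5) by (auto simp: vec.dim_insert vec.span_singleton)
  then have "vec.span {x, y} = V"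
    using V assms vec.span_minimal[of "{x, y}" V] by (intro vec.subspace_dim_equal) auto
  then have "v \<in> vec.span {x, y}" using assms by simp
  then obtain k where "v - k *s x \<in> vec.span {y}" using vec.span_breakdown_eq by blast
  then obtain m where "v - k *s x = m *s y" by (auto simp: vec.span_singleton)
  then show thesis using that by (metis add.commute diff_add_cancel)
qed

text \<open>Projecting along \<open>L k\<close> means forgetting the summand in \<open>L k\<close>:
  the span of \<open>y + w\<close> and \<open>L k\<close> is that of \<open>y\<close> and
  \<open>L k\<close>, and since \<open>L k\<close> meets \<open>L j\<close> only in 0, just the
  multiples of \<open>y\<close> remain in \<open>L j\<close>.\<close>

lemma line_map_span:
  fixes L :: "nat \<Rightarrow> ('a::field ^ 4) set"
  assumes "vec.subspace (L i)" "vec.subspace (L j)" "vec.subspace (L k)" "L j \<inter> L k \<subseteq> {0}"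
    and "y + w \<in> L i" "y + w \<noteq> 0" "y \<in> L j" "w \<in> L k"
  shows "line_map L i j k (vec.span {y + w}) = vec.span {y}"
proof -
  have "vec.span (vec.span {y + w} \<union> L k) \<inter> L j = vec.span {y}"
  proof (intro equalityI subsetI)
    fix v assume v: "v \<in> vec.span (vec.span {y + w} \<union> L k) \<inter> L j"
    then have "v \<in> {a + b | a b. a \<in> vec.span {y + w} \<and> b \<in> L k}"
      using assms(3) vec.span_Un[of "vec.span {y + w}" "L k"] by (auto simp: vec.span_eq_iff[THEN iffD2])
    then obtain c b where b: "b \<in> L k" "v = c *s (y + w) + b" by (auto simp: vec.span_singleton)
    then have "v - c *s y = c *s w + b" by (simp add: algebra_simps vector_add_ldistrib)
    moreover have "v - c *s y \<in> L j" using v assms by (auto intro: vec.subspace_diff vec.subspace_scale)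
    moreover have "c *s w + b \<in> L k" using b assms by (auto intro: vec.subspace_add vec.subspace_scale)
    ultimately have "v - c *s y = 0" using assms(4) by auto
    then show "v \<in> vec.span {y}" by (auto simp: vec.span_singleton)
  next
    fix v assume "v \<in> vec.span {y}"
    then obtain c where c: "v = c *s y" by (auto simp: vec.span_singleton)
    have "v = c *s (y + w) - c *s w" by (simp add: c vector_add_ldistrib)
    moreover have "y + w \<in> vec.span {y + w}" by (rule vec.span_base) simp
    ultimately have "v \<in> vec.span (vec.span {y + w} \<union> L k)"
      using assms(8) by (metis UnI1 UnI2 vec.span_base vec.span_diff vec.span_scale)
    then show "v \<in> vec.span (vec.span {y + w} \<union> L k) \<inter> L j"
      using c assms by (auto intro: vec.subspace_scale)
  qed
  then show ?thesis
    using proj_points_span[OF assms(1,5,6)] by (simp add: line_map_def)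
qed

text \<open>Newton interpolation at the nodes \<open>t 0\<close> and \<open>t 1\<close>. The left
  side of \<open>eq\<close> is (t 0 - t 1) u[t 0, t 1, t k], so the second divided difference is the
  same for all k and Newton's quadratic is exact at every \<open>t k\<close>.\<close>

lemma quadratic_through_points:
  fixes t u :: "nat \<Rightarrow> 'f::field"
  assumes t: "inj_on t {..<s}" and s: "2 \<le> s"
    and eq: "\<And>k. \<lbrakk>k < s; k \<noteq> 0; k \<noteq> 1\<rbrakk> \<Longrightarrow>
      (u 0 - u k) / (t 0 - t k) - (u 1 - u k) / (t 1 - t k) = d"
  shows "\<exists>\<alpha> \<beta> \<gamma>. \<forall>i<s. u i = \<alpha> + \<beta> * t i + \<gamma> * (t i)\<^sup>2"
proof -
  have ne: "t i \<noteq> t j" if "i < s" "j < s" "i \<noteq> j" for i j using t that by (auto dest: inj_onD)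
  have t01: "t 0 \<noteq> t 1" using ne[of 0 1] s by simp
  \<comment> \<open>\<open>g\<close> is the common second divided difference and \<open>f\<close>
    the first one at \<open>t 0\<close>, \<open>t 1\<close>: the coefficients of Newton's
    form.\<close>
  define g where "g = d / (t 0 - t 1)"
  define f where "f = (u 1 - u 0) / (t 1 - t 0)"
  have d: "d = g * (t 0 - t 1)" and f: "f * (t 1 - t 0) = u 1 - u 0"
    using t01 by (auto simp: g_def f_def)
  have "u k = u 0 + f * (t k - t 0) + g * (t k - t 0) * (t k - t 1)" if k: "k < s" for k
  proof -
    consider "k = 0" | "k = 1" | "k \<noteq> 0" "k \<noteq> 1" by blast
    then show ?thesis
    proof cases
      case 3
      have ne0: "t 0 - t k \<noteq> 0" "t 1 - t k \<noteq> 0" using ne[of 0 k] ne[of 1 k] 3 k s by auto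
      have "(u 0 - u k) * (t 1 - t k) - (u 1 - u k) * (t 0 - t k) = d * ((t 0 - t k) * (t 1 - t k))"
        using eq[OF k 3] ne0 by (simp add: divide_simps)
      then have "(u 0 - u k) * (t 1 - t k) - (u 1 - u k) * (t 0 - t k) =
          g * (t 0 - t 1) * ((t 0 - t k) * (t 1 - t k))" by (simp add: d)
      then have "(t 0 - t 1) * u k = (t 0 - t 1) * (u 0 + f * (t k - t 0) + g * (t k - t 0) * (t k - t 1))"
      proof -
        have "(t 0 - t 1) * u k = ((u 0 - u k) * (t 1 - t k) - (u 1 - u k) * (t 0 - t k)) -
            u 0 * (t 1 - t k) + u 1 * (t 0 - t k)"
          by (simp add: algebra_simps)
        also have "\<dots> = (t 0 - t 1) * u 0 - (u 1 - u 0) * (t k - t 0) + g * (t 0 - t 1) * ((t 0 - t k) * (t 1 - t k))"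
          using \<open>_ = g * (t 0 - t 1) * ((t 0 - t k) * (t 1 - t k))\<close> by (simp add: algebra_simps)
        also have "\<dots> = (t 0 - t 1) * (u 0 + f * (t k - t 0) + g * (t k - t 0) * (t k - t 1))"
          unfolding f[symmetric] by (simp add: algebra_simps)
        finally show ?thesis .
      qed
      then show ?thesis using t01 by simp
    qed (use f in \<open>auto simp: algebra_simps\<close>)
  qed
  then have "\<forall>i<s. u i = (u 0 - f * t 0 + g * t 0 * t 1) + (f - g * (t 0 + t 1)) * t i + g * (t i)\<^sup>2"
    by (auto simp: algebra_simps power2_eq_square)
  then show ?thesis by blast
qed

section \<open>Groupoids of translations\<close>

text \<open>In characteristic p an element has at most p multiples, so \<open>D\<close> generates a
  finite additive group. Closure under adding one generator at a time is the form that an induction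
  over arrows consumes.\<close>

lemma finite_additive_closure:
  fixes D :: "'f::field set"
  assumes "finite D" "CHAR('f) > 0"
  shows "\<exists>S. finite S \<and> 0 \<in> S \<and> (\<forall>x\<in>S. \<forall>d\<in>D. x + d \<in> S)"
  using assms(1)
proof (induction rule: finite_induct)
  case (insert d D)
  then obtain S where S: "finite S" "0 \<in> S" "\<And>x d. x \<in> S \<Longrightarrow> d \<in> D \<Longrightarrow> x + d \<in> S" by blast
  let ?S = "(\<lambda>(x, n). x + of_nat n * d) ` (S \<times> {..<CHAR('f)})"
  have mem: "x + of_nat n * d \<in> ?S" if "x \<in> S" for x n
  proof -
    have "of_nat n = (of_nat (n mod CHAR('f)) :: 'f)"
    proof -
      have "of_nat n = (of_nat (CHAR('f) * (n div CHAR('f)) + n mod CHAR('f)) :: 'f)" by simp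
      also have "\<dots> = of_nat (n mod CHAR('f))" unfolding of_nat_add of_nat_mult by simp
      finally show ?thesis .
    qed
    then show ?thesis using that assms(2) by (intro image_eqI[of _ _ "(x, n mod CHAR('f))"]) auto
  qed
  have "y + e \<in> ?S" if "y \<in> ?S" "e \<in> insert d D" for y e
  proof -
    obtain x n where x: "x \<in> S" "y = x + of_nat n * d" using \<open>y \<in> ?S\<close> by auto
    show ?thesis
    proof (cases "e = d")
      case True
      then show ?thesis using mem[OF x(1), of "Suc n"] x by (simp add: algebra_simps)
    next
      case False
      then show ?thesis using mem[OF S(3)[OF x(1), of e], of n] that x by (simp add: algebra_simps)
    qed
  qed
  moreover have "0 \<in> ?S" using mem[OF S(2), of 0] by simp
  ultimately show ?case using S(1) by (intro exI[of _ ?S]) auto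
qed (use exI[of _ "{0}"] in auto)

text \<open>\<open>Fix\<close> stands for the points on T and \<open>z\<close> for the affine
  coordinate off T. Since the points may live over a smaller field, \<open>z\<close> has values in a
  field of its own and is injective, not surjective, on a line. Likewise a line has at most one
  point in \<open>Fix\<close>, and possibly none if T is not rational.\<close>

locale translation_config =
  fixes s :: nat
    and L :: "nat \<Rightarrow> ('a::field ^ 4) set"
    and Fix :: "('a ^ 4) set set"
    and z :: "('a ^ 4) set \<Rightarrow> 'f::field"
    and \<delta> :: "nat \<Rightarrow> nat \<Rightarrow> nat \<Rightarrow> 'f"
  assumes three_le: "3 \<le> s"
    and disjoint: "\<lbrakk>i < s; j < s; i \<noteq> j\<rbrakk> \<Longrightarrow> proj_points (L i) \<inter> proj_points (L j) = {}"
    and affine_point: "i < s \<Longrightarrow> \<exists>p. p \<in> proj_points (L i) \<and> p \<notin> Fix"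
    and fixed_unique: "\<lbrakk>i < s; p \<in> proj_points (L i); q \<in> proj_points (L i); p \<in> Fix; q \<in> Fix\<rbrakk> \<Longrightarrow> p = q"
    and z_inj: "\<lbrakk>i < s; p \<in> proj_points (L i); q \<in> proj_points (L i); p \<notin> Fix; q \<notin> Fix; z p = z q\<rbrakk> \<Longrightarrow> p = q"
    and step_mem: "\<lbrakk>i < s; j < s; k < s; j \<noteq> i; k \<noteq> i; k \<noteq> j; p \<in> proj_points (L i)\<rbrakk>
      \<Longrightarrow> line_map L i j k p \<in> proj_points (L j)"
    and step_fixed: "\<lbrakk>i < s; j < s; k < s; j \<noteq> i; k \<noteq> i; k \<noteq> j; p \<in> proj_points (L i)\<rbrakk>
      \<Longrightarrow> line_map L i j k p \<in> Fix \<longleftrightarrow> p \<in> Fix"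
    and step_z: "\<lbrakk>i < s; j < s; k < s; j \<noteq> i; k \<noteq> i; k \<noteq> j; p \<in> proj_points (L i); p \<notin> Fix\<rbrakk>
      \<Longrightarrow> z (line_map L i j k p) = z p + \<delta> i j k"
    and \<delta>_flip: "\<delta> j i k = - \<delta> i j k"
    and nontrivial_loop: "\<exists>i j k l. i < s \<and> j < s \<and> k < s \<and> l < s \<and> j \<noteq> i \<and> k \<noteq> i \<and> k \<noteq> j \<and>
      l \<noteq> i \<and> l \<noteq> j \<and> \<delta> i j k + \<delta> j i l \<noteq> 0"
begin

section \<open>Arrows as translations\<close>

abbreviation "P i \<equiv> proj_points (L i)"

abbreviation "Hom i j \<equiv> groupoid_hom s L i j"

definition base :: "nat \<Rightarrow> ('a ^ 4) set" where
  "base i = (SOME p. p \<in> P i \<and> p \<notin> Fix)"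

text \<open>The translation length, read off at an arbitrary affine point of the source;
  \<open>hom_shift\<close> shows that the point does not matter.\<close>

definition shift :: "nat \<Rightarrow> (('a ^ 4) set \<Rightarrow> ('a ^ 4) set) \<Rightarrow> 'f" where
  "shift i g = z (g (base i)) - z (base i)"

lemma base: assumes "i < s" shows "base i \<in> P i" "base i \<notin> Fix"
  using someI_ex[OF affine_point[OF assms]] by (auto simp: base_def)

text \<open>One induction carries all invariants together, because the formula for the next step
  applies only to points on the right line and off \<open>Fix\<close>.\<close>

lemma arrow_translation:
  assumes "(i, j, g) \<in> arrows s L"
  shows "i < s \<and> j < s \<and> g \<in> extensional (P i) \<and> (\<forall>p\<in>P i. g p \<in> P j \<and> (g p \<in> Fix \<longleftrightarrow> p \<in> Fix)) \<and>
    (\<exists>d. \<forall>p\<in>P i. p \<notin> Fix \<longrightarrow> z (g p) = z p + d)"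
  using assms
proof (induction rule: arrows.induct)
  case (ident i)
  have "z ((\<lambda>p\<in>P i. p) p) = z p + 0" if "p \<in> P i" for p using that by simp
  then show ?case using ident restrict_extensional[of "\<lambda>p. p" "P i"] by (metis restrict_apply')
next
  case (comp i j g k l)
  then obtain d where d: "\<And>p. p \<in> P i \<Longrightarrow> p \<notin> Fix \<Longrightarrow> z (g p) = z p + d" by blast
  have "z (compose (P i) (line_map L j k l) g p) = z p + (d + \<delta> j k l)" if "p \<in> P i" "p \<notin> Fix" for p
    using that comp d[OF that] by (simp add: compose_def step_z algebra_simps)
  moreover have "compose (P i) (line_map L j k l) g p \<in> P k \<and>
      (compose (P i) (line_map L j k l) g p \<in> Fix \<longleftrightarrow> p \<in> Fix)" if "p \<in> P i" for p
    using that comp by (simp add: compose_def step_mem step_fixed)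
  ultimately show ?case using comp by (auto simp: compose_extensional)
qed

lemma hom_index: "g \<in> Hom i j \<Longrightarrow> i < s" "g \<in> Hom i j \<Longrightarrow> j < s"
  and hom_extensional: "g \<in> Hom i j \<Longrightarrow> g \<in> extensional (P i)"
  and hom_mem: "g \<in> Hom i j \<Longrightarrow> p \<in> P i \<Longrightarrow> g p \<in> P j"
  and hom_fixed: "g \<in> Hom i j \<Longrightarrow> p \<in> P i \<Longrightarrow> g p \<in> Fix \<longleftrightarrow> p \<in> Fix"
  by (auto simp: groupoid_hom_def dest: arrow_translation)

lemma hom_shift:
  assumes "g \<in> Hom i j" "p \<in> P i" "p \<notin> Fix"
  shows "z (g p) = z p + shift i g"
proof -
  obtain d where "\<forall>p\<in>P i. p \<notin> Fix \<longrightarrow> z (g p) = z p + d"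
    using assms(1) arrow_translation[of i j g] by (auto simp: groupoid_hom_def)
  with base[OF hom_index(1)[OF assms(1)]] assms show ?thesis by (simp add: shift_def)
qed

lemma shift_eqI:
  assumes "g \<in> Hom i j" "p \<in> P i" "p \<notin> Fix" "z (g p) = z p + d"
  shows "shift i g = d"
  using hom_shift[OF assms(1-3)] assms(4) by simp

text \<open>Off \<open>Fix\<close> the image is found from its coordinate, and a point of
  \<open>Fix\<close> can only go to the one point of \<open>Fix\<close> on the target line. From
  here on, identities between arrows are checked on shifts.\<close>

lemma hom_eqI_ext:
  assumes "g \<in> Hom i j" "h \<in> Hom i j" "shift i g = shift i h"
  shows "g = h"
proof (rule extensionalityI[OF hom_extensional hom_extensional, OF assms(1,2)])
  fix p assume p: "p \<in> P i"
  show "g p = h p"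
  proof (cases "p \<in> Fix")
    case True
    then show ?thesis using p assms hom_mem hom_fixed hom_index by (meson fixed_unique)
  next
    case False
    have "z (g p) = z (h p)" using hom_shift p False assms by metis
    then show ?thesis using p False assms hom_mem hom_fixed hom_index by (meson z_inj)
  qed
qed

lemma hom_id: "i < s \<Longrightarrow> (\<lambda>p\<in>P i. p) \<in> Hom i i"
  by (simp add: groupoid_hom_def arrows.ident)

lemma shift_id: "i < s \<Longrightarrow> shift i (\<lambda>p\<in>P i. p) = 0"
  using base[of i] by (simp add: shift_def)

text \<open>Arrows grow by a step at the target end, so the induction runs over the second arrow and
  reassociates.\<close>

lemma hom_compose:
  assumes g: "g \<in> Hom i j" and h: "h \<in> Hom j k"
  shows "compose (P i) h g \<in> Hom i k"
proof -
  have "(j, k, h) \<in> arrows s L \<Longrightarrow> (i, j, g) \<in> arrows s L \<Longrightarrow> (i, k, compose (P i) h g) \<in> arrows s L"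
  proof (induction rule: arrows.induct)
    case (ident j)
    have "compose (P i) (\<lambda>p\<in>P j. p) g = g"
      using arrow_translation[OF ident(2)] by (intro Id_compose) auto
    then show ?case using ident(2) by metis
  next
    case (comp j j' h k l)
    have "compose (P i) (compose (P j) (line_map L j' k l) h) g =
        compose (P i) (line_map L j' k l) (compose (P i) h g)"
      using arrow_translation[OF comp.prems] by (intro compose_assoc[symmetric]) auto
    then show ?case using comp by (auto intro: arrows.comp)
  qed
  then show ?thesis using g h by (simp add: groupoid_hom_def)
qed

lemma shift_compose:
  assumes "g \<in> Hom i j" "h \<in> Hom j k"
  shows "shift i (compose (P i) h g) = shift i g + shift j h"
proof (rule shift_eqI[OF hom_compose[OF assms]])
  note b = base[OF hom_index(1)[OF assms(1)]]
  show "base i \<in> P i" "base i \<notin> Fix" by (fact b)+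
  show "z (compose (P i) h g (base i)) = z (base i) + (shift i g + shift j h)"
    using b hom_shift[OF assms(1) b] hom_shift[OF assms(2), of "g (base i)"]
      hom_mem[OF assms(1)] hom_fixed[OF assms(1)]
    by (simp add: compose_def)
qed

text \<open>The constructor appends a step to an arrow, so a single step appears composed with the
  identity.\<close>

lemma hom_step:
  assumes "j < s" "k < s" "l < s" "k \<noteq> j" "l \<noteq> j" "l \<noteq> k"
  shows "compose (P j) (line_map L j k l) (\<lambda>p\<in>P j. p) \<in> Hom j k"
    and "shift j (compose (P j) (line_map L j k l) (\<lambda>p\<in>P j. p)) = \<delta> j k l"
proof -
  show *: "compose (P j) (line_map L j k l) (\<lambda>p\<in>P j. p) \<in> Hom j k"
    using assms arrows.ident arrows.comp by (fastforce simp: groupoid_hom_def)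
  show "shift j (compose (P j) (line_map L j k l) (\<lambda>p\<in>P j. p)) = \<delta> j k l"
    using assms base[of j] by (intro shift_eqI[OF *]) (auto simp: compose_def step_z)
qed

text \<open>A step is undone by the step back along the same third line, which has the opposite
  shift. Naming the inverse through its shift is enough, since a loop of shift 0 is the identity
  (\<open>hom_inverse_compose\<close>).\<close>

lemma hom_inverse:
  assumes "g \<in> Hom i j"
  shows "\<exists>h\<in>Hom j i. shift j h = - shift i g"
proof -
  have "(i, j, g) \<in> arrows s L \<Longrightarrow> \<exists>h\<in>Hom j i. shift j h = - shift i g"
  proof (induction rule: arrows.induct)
    case (ident i)
    then show ?case using hom_id[of i] shift_id[of i] by (metis minus_zero)
  next
    case (comp i j g k l)
    then obtain h where h: "h \<in> Hom j i" "shift j h = - shift i g" by blast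
    have j: "j < s" and g: "g \<in> Hom i j" using comp by (auto dest: arrow_translation simp: groupoid_hom_def)
    define f where "f = compose (P k) (line_map L k j l) (\<lambda>p\<in>P k. p)"
    have f: "f \<in> Hom k j" "shift k f = \<delta> k j l" using hom_step[of k j l] comp j by (auto simp: f_def)
    define f' where "f' = compose (P j) (line_map L j k l) (\<lambda>p\<in>P j. p)"
    have f': "f' \<in> Hom j k" "shift j f' = \<delta> j k l" using hom_step[of j k l] comp j by (auto simp: f'_def)
    have "compose (P i) (line_map L j k l) g = compose (P i) f' g"
      using hom_mem[OF g] by (auto simp: fun_eq_iff compose_def f'_def)
    moreover have "shift k (compose (P k) h f) = - shift i (compose (P i) f' g)"
      using shift_compose[OF f(1) h(1)] shift_compose[OF g f'(1)] h f f' \<delta>_flip[of k j l] by simp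
    ultimately show ?case using hom_compose[OF f(1) h(1)] by metis
  qed
  then show ?thesis using assms by (simp add: groupoid_hom_def)
qed

lemma hom_inverse_compose:
  assumes "g \<in> Hom i j" "h \<in> Hom j i" "shift j h = - shift i g"
  shows "compose (P i) h g = (\<lambda>p\<in>P i. p)"
  using assms hom_index[OF assms(1)]
  by (intro hom_eqI_ext[OF hom_compose[OF assms(1,2)] hom_id]) (simp_all add: shift_compose shift_id)

lemma hom_bij_betw:
  assumes g: "g \<in> Hom i j"
  shows "bij_betw g (P i) (P j)"
proof -
  obtain h where h: "h \<in> Hom j i" "shift j h = - shift i g" using hom_inverse[OF g] by blast
  have "h (g p) = p" if "p \<in> P i" for p
    using fun_cong[OF hom_inverse_compose[OF g h], of p] that by (simp add: compose_def)
  moreover have "g (h p) = p" if "p \<in> P j" for p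
    using fun_cong[OF hom_inverse_compose[OF h(1) g], of p] that h by (simp add: compose_def)
  ultimately show ?thesis
    using hom_mem[OF g] hom_mem[OF h(1)] by (intro bij_betw_byWitness[where f' = h]) auto
qed

lemma hom_nonempty:
  assumes "i < s" "j < s"
  shows "\<exists>g. g \<in> Hom i j"
proof (cases "i = j")
  case False
  have "\<exists>l<3. l \<noteq> i \<and> l \<noteq> j" by presburger
  then obtain l where "l < s" "l \<noteq> i" "l \<noteq> j" using three_le order_less_le_trans by blast
  then show ?thesis using hom_step(1)[of i j l] assms False by blast
qed (use hom_id assms in blast)

section \<open>Translation lengths: an additive group and its cosets\<close>

definition shifts :: "nat \<Rightarrow> nat \<Rightarrow> 'f set" where
  "shifts i j = shift i ` Hom i j"

lemma shifts_add:
  assumes "a \<in> shifts i j" "b \<in> shifts j k"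
  shows "a + b \<in> shifts i k"
proof -
  obtain g h where "g \<in> Hom i j" "h \<in> Hom j k" "a = shift i g" "b = shift j h"
    using assms by (auto simp: shifts_def)
  then show ?thesis
    unfolding shifts_def using shift_compose[of g i j h k] hom_compose[of g i j h k] by (metis imageI)
qed

lemma shifts_uminus:
  assumes "a \<in> shifts i j"
  shows "- a \<in> shifts j i"
proof -
  obtain g where "g \<in> Hom i j" "a = shift i g" using assms by (auto simp: shifts_def)
  then show ?thesis unfolding shifts_def using hom_inverse[of g i j] by (metis imageI)
qed

lemma shifts_0: "i < s \<Longrightarrow> 0 \<in> shifts i i"
  unfolding shifts_def using hom_id[of i] shift_id[of i] by (metis imageI)

text \<open>Conjugation by an arrow of shift c changes nothing in a commutative group: -c + a + c =
  a. The groups at different lines therefore have equal, not just isomorphic, sets of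
  shifts.\<close>

lemma shifts_loop_eq:
  assumes "i < s" "j < s"
  shows "shifts i i = shifts j j"
proof -
  have "shifts i i \<subseteq> shifts j j" if "i < s" "j < s" for i j
  proof
    fix a assume a: "a \<in> shifts i i"
    have "\<exists>g. g \<in> Hom i j" using hom_nonempty that by blast
    then obtain c where c: "c \<in> shifts i j" by (auto simp: shifts_def)
    show "a \<in> shifts j j"
      using shifts_add[OF shifts_add[OF shifts_uminus[OF c] a] c] by (simp add: algebra_simps)
  qed
  then show ?thesis using assms by blast
qed

lemma shifts_coset:
  assumes "c \<in> shifts i j"
  shows "shifts i j = (+) c ` shifts i i"
proof safe
  fix a assume "a \<in> shifts i j"
  then show "a \<in> (+) c ` shifts i i"
    using shifts_add[OF _ shifts_uminus[OF assms], of a i] by (auto intro!: image_eqI[of _ _ "a - c"])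
next
  fix a assume "a \<in> shifts i i"
  then show "c + a \<in> shifts i j" using shifts_add assms by (metis add.commute)
qed

lemma shifts_nontrivial:
  assumes "i < s"
  shows "\<exists>d\<in>shifts i i. d \<noteq> 0"
proof -
  obtain a b k l where *: "a < s" "b < s" "k < s" "l < s" "b \<noteq> a" "k \<noteq> a" "k \<noteq> b" "l \<noteq> a" "l \<noteq> b"
    "\<delta> a b k + \<delta> b a l \<noteq> 0"
    using nontrivial_loop by blast
  then have "\<delta> a b k \<in> shifts a b" "\<delta> b a l \<in> shifts b a"
    unfolding shifts_def using hom_step[of a b k] hom_step[of b a l] by (metis imageI)+
  then show ?thesis using * shifts_add shifts_loop_eq[OF assms] by metis
qed

lemma shift_bij_betw: "bij_betw (shift i) (Hom i j) (shifts i j)"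
  unfolding shifts_def bij_betw_def using hom_eqI_ext by (auto intro: inj_onI)


section \<open>Vertex groups inside the additive group of the field\<close>

lemma hom_subset_Bij: "Hom i i \<subseteq> Bij (P i)"
  using hom_extensional hom_bij_betw by (auto simp: Bij_def)

lemma line_group_simps:
  "carrier (line_group s L i) = Hom i i"
  "\<one>\<^bsub>line_group s L i\<^esub> = (\<lambda>p\<in>P i. p)"
  by (simp_all add: line_group_def BijGroup_def)

lemma line_group_mult:
  "\<lbrakk>g \<in> Hom i i; h \<in> Hom i i\<rbrakk> \<Longrightarrow> g \<otimes>\<^bsub>line_group s L i\<^esub> h = compose (P i) g h"
  using hom_subset_Bij[of i] by (auto simp: line_group_def BijGroup_def)

text \<open>The laws are inherited from addition: \<open>shift\<close> turns composition into a sum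
  and is injective.\<close>

lemma group_line_group:
  assumes "i < s"
  shows "group (line_group s L i)"
proof (rule groupI, unfold line_group_simps)
  show "(\<lambda>p\<in>P i. p) \<in> Hom i i" by (rule hom_id[OF assms])
next
  fix g h assume "g \<in> Hom i i" "h \<in> Hom i i"
  then show "g \<otimes>\<^bsub>line_group s L i\<^esub> h \<in> Hom i i"
    by (simp add: line_group_simps line_group_mult hom_compose)
next
  fix f g h assume "f \<in> Hom i i" "g \<in> Hom i i" "h \<in> Hom i i"
  then show "f \<otimes>\<^bsub>line_group s L i\<^esub> g \<otimes>\<^bsub>line_group s L i\<^esub> h =
      f \<otimes>\<^bsub>line_group s L i\<^esub> (g \<otimes>\<^bsub>line_group s L i\<^esub> h)"
    by (simp add: line_group_simps line_group_mult hom_compose)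
      (rule hom_eqI_ext[of _ i i]; simp add: shift_compose[of _ i i _ i] hom_compose[of _ i i])
next
  fix g assume g: "g \<in> Hom i i"
  then show "(\<lambda>p\<in>P i. p) \<otimes>\<^bsub>line_group s L i\<^esub> g = g"
    using hom_id[OF assms] shift_id[OF assms]
    by (intro hom_eqI_ext[of _ i i]) (simp_all only: line_group_simps line_group_mult shift_compose hom_compose add_0_right)
  obtain h where "h \<in> Hom i i" "shift i h = - shift i g" using hom_inverse[OF g] by blast
  then show "\<exists>h\<in>Hom i i. h \<otimes>\<^bsub>line_group s L i\<^esub> g = (\<lambda>p\<in>P i. p)"
    using hom_inverse_compose[OF g] g by (metis line_group_mult)
qed

lemma comm_group_line_group:
  assumes "i < s"
  shows "comm_group (line_group s L i)"
proof (rule group.group_comm_groupI[OF group_line_group[OF assms]], unfold line_group_simps)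
  fix g h assume "g \<in> Hom i i" "h \<in> Hom i i"
  then show "g \<otimes>\<^bsub>line_group s L i\<^esub> h = h \<otimes>\<^bsub>line_group s L i\<^esub> g"
    by (intro hom_eqI_ext[of _ i i]) (simp_all add: line_group_simps line_group_mult hom_compose shift_compose)
qed

lemma line_group_iso_shifts:
  assumes "i < s"
  shows "line_group s L i \<cong> (add_monoid ring_of_type_algebra)\<lparr>carrier := shifts i i\<rparr>"
proof -
  have "shift i \<in> iso (line_group s L i) ((add_monoid ring_of_type_algebra)\<lparr>carrier := shifts i i\<rparr>)"
    using shift_bij_betw[of i i]
    by (auto simp: iso_def hom_def line_group_simps line_group_mult shift_compose shifts_def ring_of_type_algebra_def)
  then show ?thesis by (auto simp: is_iso_def)
qed

lemma subgroup_shifts: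
  assumes "i < s"
  shows "subgroup (shifts i i) (add_monoid ring_of_type_algebra)"
proof -
  have ring: "ring (ring_of_type_algebra :: 'f ring)" by (rule ring_from_type_algebra)
  interpret G: group "add_monoid (ring_of_type_algebra :: 'f ring)"
    by (rule abelian_group.a_group[OF ring.is_abelian_group[OF ring]])
  have inv: "inv\<^bsub>add_monoid ring_of_type_algebra\<^esub> a = - a" for a :: 'f
    by (rule G.inv_equality) (simp_all add: ring_of_type_algebra_def)
  show ?thesis
    by (rule G.subgroupI)
      (use shifts_0[OF assms] shifts_uminus[of _ i i] shifts_add[of _ i i] in
        \<open>auto simp only: inv\<close>, auto simp: ring_of_type_algebra_def shifts_add)
qed

section \<open>The transported action on each line\<close>

lemma line_action_hom:
  assumes h: "h \<in> Hom i j" and g: "g \<in> Hom i i"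
  shows "line_action L i j h g \<in> Hom j j" and "shift j (line_action L i j h g) = shift i g"
proof -
  obtain k where k: "k \<in> Hom j i" "shift j k = - shift i h" using hom_inverse[OF h] by blast
  have "inv_into (P i) h p = k p" if "p \<in> P j" for p
  proof -
    have "h (k p) = p" using fun_cong[OF hom_inverse_compose[OF k(1) h], of p] that k by (simp add: compose_def)
    then show ?thesis
      using hom_bij_betw[OF h] hom_mem[OF k(1) that] by (metis bij_betw_imp_inj_on inv_into_f_eq)
  qed
  \<comment> \<open>On \<open>P j\<close> the inverse of \<open>h\<close> is the arrow
    \<open>k\<close>, so transport is conjugation by \<open>h\<close>, and the shifts of
    \<open>h\<close> and \<open>k\<close> cancel.\<close>
  then have *: "line_action L i j h g = compose (P j) h (compose (P j) g k)"
    by (auto simp: line_action_def compose_def fun_eq_iff)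
  show "line_action L i j h g \<in> Hom j j" unfolding * by (rule hom_compose[OF hom_compose[OF k(1) g] h])
  show "shift j (line_action L i j h g) = shift i g"
    unfolding * using shift_compose[OF hom_compose[OF k(1) g] h] shift_compose[OF k(1) g] k by simp
qed

lemma faithful_line_action:
  assumes h: "h \<in> Hom i j"
  shows "faithful_action (line_group s L i) (P j) (line_action L i j h)"
proof -
  have "line_action L i j h \<in> Group.hom (line_group s L i) (BijGroup (P j))"
  proof (rule homI, unfold line_group_simps)
    fix g g' assume g: "g \<in> Hom i i" "g' \<in> Hom i i"
    note la = line_action_hom[OF h]
    show "line_action L i j h g \<in> carrier (BijGroup (P j))"
      using la g hom_subset_Bij[of j] by (auto simp: BijGroup_def)
    have "line_action L i j h (compose (P i) g g') = compose (P j) (line_action L i j h g) (line_action L i j h g')"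
      using g shift_compose[OF la(1)[OF g(2)] la(1)[OF g(1)]]
      by (intro hom_eqI_ext[of _ j j]) (simp_all add: la hom_compose[of _ j j] hom_compose[of _ i i] shift_compose[of _ i i])
    then show "line_action L i j h (g \<otimes>\<^bsub>line_group s L i\<^esub> g') =
        line_action L i j h g \<otimes>\<^bsub>BijGroup (P j)\<^esub> line_action L i j h g'"
      using g la hom_subset_Bij[of j] by (auto simp: line_group_mult BijGroup_def)
  qed
  moreover have "inj_on (line_action L i j h) (Hom i i)"
    using line_action_hom[OF h] by (auto intro!: inj_onI hom_eqI_ext) metis
  ultimately show ?thesis
    using group_line_group[OF hom_index(1)[OF h]] group_BijGroup
    by (simp add: faithful_action_def faithful_action_axioms_def group_action_def group_hom_def
        group_hom_axioms_def line_group_simps)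
qed

text \<open>A translation with an affine fixed point has length 0.\<close>

lemma stabilizer_affine:
  assumes h: "h \<in> Hom i j" and p: "p \<in> P j" "p \<notin> Fix"
  shows "stabilizer (line_group s L i) (line_action L i j h) p = {\<one>\<^bsub>line_group s L i\<^esub>}"
proof -
  have i: "i < s" by (rule hom_index(1)[OF h])
  have eq: "line_action L i j h g p = p \<longleftrightarrow> g = (\<lambda>p\<in>P i. p)" if g: "g \<in> Hom i i" for g
  proof -
    note la = line_action_hom[OF h g]
    have "line_action L i j h g p = p \<longleftrightarrow> z (line_action L i j h g p) = z p"
      using hom_mem[OF la(1) p(1)] hom_fixed[OF la(1) p(1)] p z_inj[OF hom_index(2)[OF h]] by metis
    also have "\<dots> \<longleftrightarrow> shift i g = 0" using hom_shift[OF la(1) p] la(2) by simp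
    also have "\<dots> \<longleftrightarrow> g = (\<lambda>p\<in>P i. p)"
      using hom_eqI_ext[OF g hom_id[OF i]] shift_id[OF i] by metis
    finally show ?thesis .
  qed
  then show ?thesis
    using hom_id[OF i] unfolding stabilizer_def line_group_simps by blast
qed

section \<open>Orbits and their sizes\<close>

lemma orbit_eq:
  assumes "i < s" "p \<in> P i"
  shows "groupoid_orbit s L p = {g p | j g. j < s \<and> g \<in> Hom i j}"
  using assms disjoint unfolding groupoid_orbit_def by blast

lemma orbit_memI:
  assumes "i < s" "p \<in> P i" "g \<in> Hom i j"
  shows "g p \<in> groupoid_orbit s L p"
  using orbit_eq[OF assms(1,2)] assms(3) hom_index(2)[OF assms(3)] by blast

text \<open>On each line the orbit is cut out by a coset of translation lengths, because the
  coordinate identifies an affine point. Orbits can then be compared without naming arrows.\<close>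

lemma orbit_affine_iff:
  assumes "i < s" "p \<in> P i" "p \<notin> Fix"
  shows "q \<in> groupoid_orbit s L p \<longleftrightarrow> (\<exists>j<s. q \<in> P j \<and> q \<notin> Fix \<and> z q - z p \<in> shifts i j)"
proof
  assume "q \<in> groupoid_orbit s L p"
  then obtain j g where "j < s" "g \<in> Hom i j" "q = g p" using orbit_eq[OF assms(1,2)] by blast
  then show "\<exists>j<s. q \<in> P j \<and> q \<notin> Fix \<and> z q - z p \<in> shifts i j"
    using assms hom_mem hom_fixed hom_shift by (auto simp: shifts_def)
next
  assume "\<exists>j<s. q \<in> P j \<and> q \<notin> Fix \<and> z q - z p \<in> shifts i j"
  then obtain j g where *: "j < s" "q \<in> P j" "q \<notin> Fix" "g \<in> Hom i j" "z q - z p = shift i g"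
    by (auto simp: shifts_def)
  then have "z (g p) = z q" using hom_shift assms by (auto simp: algebra_simps)
  then have "q = g p" using * assms hom_mem hom_fixed z_inj by metis
  then show "q \<in> groupoid_orbit s L p" using orbit_eq[OF assms(1,2)] * by blast
qed

lemma orbit_cong:
  assumes "i < s" "p \<in> P i" "p \<notin> Fix" "q \<in> groupoid_orbit s L p"
  shows "groupoid_orbit s L q = groupoid_orbit s L p"
proof -
  obtain j where j: "j < s" "q \<in> P j" "q \<notin> Fix" "z q - z p \<in> shifts i j"
    using orbit_affine_iff[OF assms(1-3)] assms(4) by blast
  have "z r - z q \<in> shifts j k \<longleftrightarrow> z r - z p \<in> shifts i k" for r k
    using shifts_add[OF j(4), of "z r - z q" k] shifts_add[OF shifts_uminus[OF j(4)], of "z r - z p" k]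
    by auto
  then show ?thesis using orbit_affine_iff[OF assms(1-3)] orbit_affine_iff[OF j(1-3)] by blast
qed

lemma line_group_eqpoll:
  assumes "i < s" "j < s"
  shows "carrier (line_group s L i) \<approx> carrier (line_group s L j)"
  using shift_bij_betw[of i i] shift_bij_betw[of j j] shifts_loop_eq[OF assms]
  unfolding line_group_simps by (metis eqpoll_def eqpoll_sym eqpoll_trans)

text \<open>Equipollence covers infinite groups as well. With one arrow \<open>h j\<close> chosen to
  each line, an orbit point is \<open>h j (g p)\<close> for a single pair: disjointness of the lines
  gives \<open>j\<close>, and then the shift gives \<open>g\<close>.\<close>

lemma orbit_eqpoll:
  assumes "i < s" "p \<in> config_points s L" "p \<notin> Fix"
  shows "{..<s} \<times> carrier (line_group s L i) \<approx> groupoid_orbit s L p"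
proof -
  obtain k where k: "k < s" "p \<in> P k" using assms(2) by (auto simp: config_points_def)
  obtain h where h: "\<And>j. j < s \<Longrightarrow> h j \<in> Hom k j" using hom_nonempty[OF k(1)] by metis
  let ?f = "\<lambda>(j, g). h j (g p)"
  have f: "h j (g p) \<in> P j" "h j (g p) \<notin> Fix" "z (h j (g p)) = z p + shift k g + shift k (h j)"
    if "j < s" "g \<in> Hom k k" for j g
    using that h[OF that(1)] hom_mem[OF that(2) k(2)] hom_fixed[OF that(2) k(2)] assms(3)
      hom_shift[OF that(2) k(2) assms(3)] hom_shift[OF h[OF that(1)], of "g p"]
      hom_mem[OF h[OF that(1)], of "g p"] hom_fixed[OF h[OF that(1)], of "g p"] by auto
  have "bij_betw ?f ({..<s} \<times> Hom k k) (groupoid_orbit s L p)"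
    unfolding bij_betw_def
  proof
    show "inj_on ?f ({..<s} \<times> Hom k k)"
    proof (rule inj_onI, clarify)
      fix j g j' g' assume *: "j < s" "j' < s" "g \<in> Hom k k" "g' \<in> Hom k k" "h j (g p) = h j' (g' p)"
      then have "j = j'" using f(1) disjoint by (metis disjoint_iff)
      moreover from this have "shift k g = shift k g'" using * f(3) by (metis add_left_cancel add_right_cancel)
      ultimately show "j = j' \<and> g = g'" using * hom_eqI_ext by blast
    qed
    show "?f ` ({..<s} \<times> Hom k k) = groupoid_orbit s L p"
    proof safe
      fix j g assume "j < s" "g \<in> Hom k k"
      moreover from this have "compose (P k) (h j) g \<in> Hom k j" using hom_compose h by blast
      moreover have "compose (P k) (h j) g p = h j (g p)" using k by (simp add: compose_def)
      ultimately show "h j (g p) \<in> groupoid_orbit s L p" using orbit_memI[OF k] by metis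
    next
      fix q assume "q \<in> groupoid_orbit s L p"
      then obtain j f' where j: "j < s" "f' \<in> Hom k j" "q = f' p" using orbit_eq[OF k] by blast
      \<comment> \<open>\<open>f'\<close> and \<open>h j\<close> have the same source and target, so
        their shifts differ by that of a loop \<open>g\<close>.\<close>
      then have "shift k f' \<in> (+) (shift k (h j)) ` shifts k k"
        using shifts_coset[of "shift k (h j)" k j] h[OF j(1)] by (auto simp: shifts_def)
      then obtain g where g: "g \<in> Hom k k" "shift k f' = shift k (h j) + shift k g"
        by (auto simp: shifts_def)
      have "f' = compose (P k) (h j) g"
        using g j hom_compose[OF g(1) h[OF j(1)]] shift_compose[OF g(1) h[OF j(1)]]
        by (intro hom_eqI_ext[of _ k j]) (auto simp: add.commute)
      then have "q = ?f (j, g)" using j k by (simp add: compose_def)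
      then show "q \<in> ?f ` ({..<s} \<times> Hom k k)" using g j by blast
    qed
  qed
  then have "{..<s} \<times> Hom k k \<approx> groupoid_orbit s L p" by (auto simp: eqpoll_def)
  moreover have "{..<s} \<times> Hom i i \<approx> {..<s} \<times> Hom k k"
    using line_group_eqpoll[OF assms(1) k(1)] by (auto simp: line_group_simps intro: times_eqpoll_cong)
  ultimately show ?thesis using eqpoll_trans by (auto simp: line_group_simps)
qed

text \<open>Equality would mean s * |G| = s with s finite and positive, hence a trivial group,
  against \<open>shifts_nontrivial\<close>.\<close>

lemma orbit_not_eqpoll:
  assumes "p \<in> config_points s L" "p \<notin> Fix"
  shows "\<not> {..<s} \<approx> groupoid_orbit s L p"
proof
  have s: "0 < s" using three_le by simp
  assume "{..<s} \<approx> groupoid_orbit s L p"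
  then have e: "{..<s} \<approx> {..<s} \<times> Hom 0 0"
    using orbit_eqpoll[OF s assms] eqpoll_sym eqpoll_trans unfolding line_group_simps by blast
  then have fin: "finite ({..<s} \<times> Hom 0 0)" using eqpoll_finite_iff by blast
  have "s * card (Hom 0 0) = s" using e fin by (auto simp: eqpoll_iff_card card_cartesian_product)
  then obtain g where "Hom 0 0 = {g}" using three_le by (auto simp: card_1_singleton_iff)
  then have "shifts 0 0 = {0}" using shifts_0[of 0] three_le by (auto simp: shifts_def)
  then show False using shifts_nontrivial[of 0] three_le by auto
qed

lemma orbit_lesspoll:
  assumes "p \<in> config_points s L" "p \<notin> Fix"
  shows "{..<s} \<prec> groupoid_orbit s L p"
proof -
  have s: "0 < s" using three_le by simp
  have "inj_on (\<lambda>j. (j, \<lambda>p\<in>P 0. p)) {..<s}" by (rule inj_onI) (rule Pair_inject)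
  moreover have "(\<lambda>j. (j, \<lambda>p\<in>P 0. p)) ` {..<s} \<subseteq> {..<s} \<times> Hom 0 0" using hom_id[OF s] by blast
  ultimately have "{..<s} \<lesssim> {..<s} \<times> Hom 0 0" unfolding lepoll_def by blast
  then have "{..<s} \<lesssim> groupoid_orbit s L p"
    using lepoll_trans2 orbit_eqpoll[OF s assms] unfolding line_group_simps by blast
  then show ?thesis using orbit_not_eqpoll[OF assms] by (simp add: lesspoll_def)
qed

text \<open>Arrows preserve \<open>Fix\<close>, which by \<open>fixed\<close> has exactly one point
  on each line, so these s points form one orbit. Every other orbit is larger or infinite.\<close>

lemma orbits_card_s:
  assumes fixed: "\<And>i. i < s \<Longrightarrow> \<exists>p. p \<in> P i \<and> p \<in> Fix"
  shows "{Z \<in> groupoid_orbit s L ` config_points s L. card Z = s} = {Fix \<inter> config_points s L}"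
proof -
  obtain o' where o': "\<And>i. i < s \<Longrightarrow> o' i \<in> P i \<and> o' i \<in> Fix" using fixed by metis
  have F: "Fix \<inter> config_points s L = o' ` {..<s}"
  proof (intro equalityI subsetI)
    fix q assume "q \<in> Fix \<inter> config_points s L"
    then obtain i where "i < s" "q \<in> P i" "q \<in> Fix" by (auto simp: config_points_def)
    moreover from this have "q = o' i" using o'[of i] fixed_unique by blast
    ultimately show "q \<in> o' ` {..<s}" by blast
  qed (use o' in \<open>auto simp: config_points_def\<close>)
  have "inj_on o' {..<s}" using o' disjoint by (intro inj_onI) (metis disjoint_iff lessThan_iff)
  then have card: "card (Fix \<inter> config_points s L) = s" using F by (simp add: card_image)
  have orb: "groupoid_orbit s L p = Fix \<inter> config_points s L" if p: "p \<in> config_points s L" "p \<in> Fix" for p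
  proof -
    obtain i where i: "i < s" "p \<in> P i" using p by (auto simp: config_points_def)
    show ?thesis
    proof (intro equalityI subsetI)
      fix q assume "q \<in> groupoid_orbit s L p"
      then obtain j g where "j < s" "g \<in> Hom i j" "q = g p" using orbit_eq[OF i] by blast
      then show "q \<in> Fix \<inter> config_points s L"
        using i p hom_mem[of g i j p] hom_fixed[of g i j p] by (auto simp: config_points_def)
    next
      fix q assume "q \<in> Fix \<inter> config_points s L"
      then obtain j where j: "j < s" "q \<in> P j" "q \<in> Fix" by (auto simp: config_points_def)
      obtain g where g: "g \<in> Hom i j" using hom_nonempty[OF i(1) j(1)] by blast
      then have "q = g p" using hom_mem[OF g i(2)] hom_fixed[OF g i(2)] p j fixed_unique by blast
      then show "q \<in> groupoid_orbit s L p" using orbit_memI[OF i g] by blast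
    qed
  qed
  have aff: "card (groupoid_orbit s L p) \<noteq> s" if p: "p \<in> config_points s L" "p \<notin> Fix" for p
  proof
    assume c: "card (groupoid_orbit s L p) = s"
    \<comment> \<open>\<open>card\<close> is 0 on infinite sets, so the value s > 0 forces
      finiteness.\<close>
    then have "finite (groupoid_orbit s L p)" using three_le by (intro card_ge_0_finite) simp
    then have "{..<s} \<approx> groupoid_orbit s L p" using c by (simp add: eqpoll_iff_card)
    then show False using orbit_not_eqpoll[OF p] by blast
  qed
  have "o' 0 \<in> config_points s L" "o' 0 \<in> Fix" using o'[of 0] three_le by (auto simp: config_points_def)
  then have "Fix \<inter> config_points s L \<in> groupoid_orbit s L ` config_points s L" using orb by (metis imageI)
  then show ?thesis using card orb aff by blast
qed

text \<open>A linear map that adds one constant to \<open>z\<close> on all lines carries the cosets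
  describing one orbit to those describing another.\<close>

lemma orbits_projectively_equivalent:
  assumes translation: "\<And>i p q. \<lbrakk>i < s; p \<in> P i; p \<notin> Fix; q \<in> P i; q \<notin> Fix\<rbrakk> \<Longrightarrow>
      \<exists>M :: 'a ^ 4 ^ 4. invertible M \<and> (\<forall>l<s. \<forall>r\<in>P l. r \<notin> Fix \<longrightarrow>
        (*v) M ` r \<in> P l \<and> (*v) M ` r \<notin> Fix \<and> z ((*v) M ` r) = z r + (z q - z p))"
    and p: "p \<in> config_points s L" "p \<notin> Fix" and q: "q \<in> config_points s L" "q \<notin> Fix"
  shows "projectively_equivalent (groupoid_orbit s L p) (groupoid_orbit s L q)"
proof -
  obtain i where i: "i < s" "p \<in> P i" using p by (auto simp: config_points_def)
  obtain j where j: "j < s" "q \<in> P j" using q by (auto simp: config_points_def)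
  obtain h where h: "h \<in> Hom j i" using hom_nonempty[OF j(1) i(1)] by blast
  \<comment> \<open>\<open>q\<close> may lie on another line than \<open>p\<close>; it is replaced
    by a point of its orbit on the line of \<open>p\<close>, where the two coordinates can be
    compared.\<close>
  define q' where "q' = h q"
  have q': "q' \<in> P i" "q' \<notin> Fix" using h j q hom_mem hom_fixed by (auto simp: q'_def)
  have "q' \<in> groupoid_orbit s L q" using orbit_eq[OF j] h i by (auto simp: q'_def)
  then have orb: "groupoid_orbit s L q' = groupoid_orbit s L q" by (rule orbit_cong[OF j q(2)])
  obtain M :: "'a ^ 4 ^ 4" where M: "invertible M" "\<And>l r. \<lbrakk>l < s; r \<in> P l; r \<notin> Fix\<rbrakk> \<Longrightarrow>
      (*v) M ` r \<in> P l \<and> (*v) M ` r \<notin> Fix \<and> z ((*v) M ` r) = z r + (z q' - z p)"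
    using translation[OF i(1) i(2) p(2) q'] by blast
  have "(\<lambda>p. (*v) M ` p) ` groupoid_orbit s L p = groupoid_orbit s L q'"
  proof (rule equalityI; rule subsetI)
    fix r assume "r \<in> (\<lambda>p. (*v) M ` p) ` groupoid_orbit s L p"
    then obtain r' where r': "r' \<in> groupoid_orbit s L p" "r = (*v) M ` r'" by blast
    then obtain l where l: "l < s" "r' \<in> P l" "r' \<notin> Fix" "z r' - z p \<in> shifts i l"
      using orbit_affine_iff[OF i p(2)] by blast
    moreover have "z r - z q' = z r' - z p" using M(2)[OF l(1-3)] r' by simp
    ultimately show "r \<in> groupoid_orbit s L q'"
      using M(2)[OF l(1-3)] r' orbit_affine_iff[OF i(1) q'] by metis
  next
    fix r assume "r \<in> groupoid_orbit s L q'"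
    then obtain l where l: "l < s" "r \<in> P l" "r \<notin> Fix" "z r - z q' \<in> shifts i l"
      using orbit_affine_iff[OF i(1) q'] by blast
    \<comment> \<open>The preimage of \<open>r\<close> is not computed by inverting
      \<open>M\<close>: it is the image of \<open>p\<close> under an arrow with the same shift as
      the one leading from \<open>q'\<close> to \<open>r\<close>.\<close>
    then obtain g where g: "g \<in> Hom i l" "z r - z q' = shift i g" by (auto simp: shifts_def)
    have gp: "g p \<in> P l" "g p \<notin> Fix" "z (g p) = z p + shift i g"
      using g i p hom_mem hom_fixed hom_shift by auto
    have "z ((*v) M ` g p) = z r" using M(2)[OF l(1) gp(1,2)] gp g by (simp add: algebra_simps)
    then have "(*v) M ` g p = r" using M(2)[OF l(1) gp(1,2)] l z_inj by blast
    moreover have "g p \<in> groupoid_orbit s L p" using orbit_memI[OF i g(1)] by blast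
    ultimately show "r \<in> (\<lambda>p. (*v) M ` p) ` groupoid_orbit s L p" by blast
  qed
  then show ?thesis using M(1) orb unfolding projectively_equivalent_def by metis
qed

text \<open>Finitely many steps generate all arrows, so in positive characteristic their lengths
  stay in a finite set. In characteristic 0 the multiples of one nonzero length are
  distinct.\<close>

lemma infinite_shifts_iff:
  assumes "i < s"
  shows "infinite (shifts i i) \<longleftrightarrow> CHAR('f) = 0"
proof
  assume "infinite (shifts i i)"
  show "CHAR('f) = 0"
  proof (rule ccontr)
    assume "CHAR('f) \<noteq> 0"
    \<comment> \<open>Triples with repeated indices are included; this keeps \<open>?D\<close>
      finite and simple to write.\<close>
    let ?D = "(\<lambda>(a, b, c). \<delta> a b c) ` ({..<s} \<times> {..<s} \<times> {..<s})"
    obtain S where S: "finite S" "0 \<in> S" "\<And>x d. x \<in> S \<Longrightarrow> d \<in> ?D \<Longrightarrow> x + d \<in> S"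
      using finite_additive_closure[of ?D] \<open>CHAR('f) \<noteq> 0\<close> by (metis finite_SigmaI finite_imageI finite_lessThan neq0_conv)
    have "(i, j, g) \<in> arrows s L \<Longrightarrow> shift i g \<in> S" for i j g
    proof (induction rule: arrows.induct)
      case (ident i)
      then show ?case using S(2) shift_id by metis
    next
      case (comp i j g k l)
      then have g: "g \<in> Hom i j" and j: "j < s" by (auto dest: arrow_translation simp: groupoid_hom_def)
      define f where "f = compose (P j) (line_map L j k l) (\<lambda>p\<in>P j. p)"
      have f: "f \<in> Hom j k" "shift j f = \<delta> j k l" using hom_step[of j k l] comp j by (auto simp: f_def)
      have "compose (P i) (line_map L j k l) g = compose (P i) f g"
        using hom_mem[OF g] by (auto simp: fun_eq_iff compose_def f_def)
      then have "shift i (compose (P i) (line_map L j k l) g) = shift i g + \<delta> j k l"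
        using shift_compose[OF g f(1)] f(2) by simp
      moreover have "\<delta> j k l \<in> ?D" using comp j by (auto intro!: image_eqI[of _ _ "(j, k, l)"])
      ultimately show ?case using S(3) comp by metis
    qed
    then have "shifts i i \<subseteq> S" by (auto simp: shifts_def groupoid_hom_def)
    then show False using \<open>infinite (shifts i i)\<close> S(1) finite_subset by blast
  qed
next
  assume char: "CHAR('f) = 0"
  obtain d where d: "d \<in> shifts i i" "d \<noteq> 0" using shifts_nontrivial[OF assms] by blast
  have "of_nat n * d \<in> shifts i i" for n
    by (induction n) (use shifts_0[OF assms] shifts_add d in \<open>auto simp: algebra_simps\<close>)
  moreover have "inj (\<lambda>n. of_nat n * d :: 'f)"
  proof (rule linorder_injI)
    fix m n :: nat assume "m < n"
    then have "of_nat (n - m) \<noteq> (0 :: 'f)" using char by (simp add: of_nat_eq_0_iff_char_dvd del: of_nat_diff)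
    then show "of_nat m * d \<noteq> of_nat n * d" using d \<open>m < n\<close> by (simp add: of_nat_diff)
  qed
  ultimately show "infinite (shifts i i)"
    by (metis (no_types, lifting) finite_subset image_subsetI infinite_UNIV_nat finite_imageD)
qed

lemma infinite_orbit_iff:
  assumes "p \<in> config_points s L" "p \<notin> Fix"
  shows "infinite (groupoid_orbit s L p) \<longleftrightarrow> CHAR('f) = 0"
proof -
  have "finite (groupoid_orbit s L p) \<longleftrightarrow> finite ({..<s} \<times> Hom 0 0)"
    using orbit_eqpoll[OF _ assms, of 0] three_le eqpoll_finite_iff by (fastforce simp: line_group_simps)
  also have "\<dots> \<longleftrightarrow> finite (Hom 0 0)"
    using three_le by (auto simp: finite_cartesian_product_iff lessThan_empty_iff)
  also have "\<dots> \<longleftrightarrow> finite (shifts 0 0)" using shift_bij_betw bij_betw_finite by blast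
  finally show ?thesis using infinite_shifts_iff[of 0] three_le by simp
qed

end

section \<open>Lines in affine coordinates\<close>

text \<open>\<open>e\<close> embeds the field of the points into the field of the coordinates; it
  will be the inclusion into the algebraic closure, or the identity. That \<open>L i\<close> is a
  line is assumed besides its equations, because equations over the larger field may have too few
  solutions over the smaller one.\<close>

locale line_coordinates =
  fixes s :: nat
    and L :: "nat \<Rightarrow> ('a::field ^ 4) set"
    and e :: "'a \<Rightarrow> 'f::field"
    and C :: "'f ^ 4 ^ 4"
    and t u :: "nat \<Rightarrow> 'f"
    and c :: "'a ^ 4 \<Rightarrow> 'f ^ 4"
  defines "c \<equiv> \<lambda>x. C *v (\<chi> i. e (x $ i))"
  assumes e_add: "e (a + b) = e a + e b"
    and e_mult: "e (a * b) = e a * e b"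
    and e_1: "e 1 = 1"
    and C_inj: "C *v v = 0 \<Longrightarrow> v = 0"
    and four_le: "4 \<le> s"
    and line: "i < s \<Longrightarrow> proj_line (L i)"
    and mem_line: "i < s \<Longrightarrow> x \<in> L i \<longleftrightarrow>
      c x $ 4 = t i * c x $ 3 \<and> c x $ 2 = t i * c x $ 1 + u i * c x $ 3"
    and t_inj: "inj_on t {..<s}"
    and not_quadratic: "\<not> (\<exists>\<alpha> \<beta> \<gamma>. \<forall>i<s. u i = \<alpha> + \<beta> * t i + \<gamma> * (t i)\<^sup>2)"
begin

definition axis_space :: "('a ^ 4) set" where
  "axis_space = {x. c x $ 3 = 0 \<and> c x $ 4 = 0}"

text \<open>The quotient is homogeneous of degree 0, so any nonzero vector of the point gives the
  same value (\<open>z_span\<close>). It is meaningful where the third coordinate is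
  nonzero.\<close>

definition z :: "('a ^ 4) set \<Rightarrow> 'f" where
  "z p = (let x = SOME x. x \<in> p \<and> x \<noteq> 0 in c x $ 1 / c x $ 3)"

text \<open>A difference of two slopes; for distinct parameters it is the multiple of the second
  divided difference by which a step translates, in a form that is visibly antisymmetric in
  \<open>i\<close> and \<open>j\<close>.\<close>

definition \<delta> :: "nat \<Rightarrow> nat \<Rightarrow> nat \<Rightarrow> 'f" where
  "\<delta> i j k = (u i - u k) / (t i - t k) - (u j - u k) / (t j - t k)"

lemma \<delta>_flip: "\<delta> j i k = - \<delta> i j k"
  by (simp add: \<delta>_def)

lemma e_0: "e 0 = 0" by (metis e_add add_cancel_left_right add_0)

lemma e_eq_0_iff: "e a = 0 \<longleftrightarrow> a = 0"
proof
  assume "e a = 0"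
  show "a = 0"
  proof (rule ccontr)
    assume "a \<noteq> 0"
    then have "e a * e (inverse a) = 1" using e_mult[of a "inverse a"] e_1 by simp
    then show False using \<open>e a = 0\<close> by simp
  qed
qed (simp add: e_0)

lemma e_diff: "e (a - b) = e a - e b" using e_add[of "a - b" b] by simp

lemma e_eq_iff: "e a = e b \<longleftrightarrow> a = b" using e_eq_0_iff[of "a - b"] by (simp add: e_diff)

lemma e_divide: "b \<noteq> 0 \<Longrightarrow> e (a / b) = e a / e b"
  using e_mult[of "a / b" b] e_eq_0_iff[of b] by (simp add: field_simps)

lemma c_add: "c (x + y) = c x + c y"
proof -
  have "(\<chi> i. e ((x + y) $ i)) = (\<chi> i. e (x $ i)) + (\<chi> i. e (y $ i))"
    by (simp add: vec_eq_iff e_add)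
  then show ?thesis by (simp add: c_def matrix_vector_right_distrib)
qed

lemma c_scale: "c (k *s x) = e k *s c x"
proof -
  have "(\<chi> i. e ((k *s x) $ i)) = e k *s (\<chi> i. e (x $ i))"
    by (simp add: vec_eq_iff e_mult)
  then show ?thesis by (simp add: c_def vector_scalar_commute)
qed

text \<open>Descent of proportionality: the ratio can be read off at a nonzero entry of
  \<open>y\<close>, where it is a quotient in the smaller field.\<close>

lemma c_eq_scale:
  assumes "c x = r *s c y" "y \<noteq> 0"
  shows "\<exists>k. x = k *s y"
proof -
  have "C *v ((\<chi> i. e (x $ i)) - r *s (\<chi> i. e (y $ i))) = 0"
    using assms(1) by (simp add: c_def matrix_vector_mult_diff_distrib vector_scalar_commute)
  then have "(\<chi> i. e (x $ i)) - r *s (\<chi> i. e (y $ i)) = 0" by (rule C_inj)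
  then have eq: "e (x $ i) = r * e (y $ i)" for i by (simp add: vec_eq_iff)
  obtain j where j: "y $ j \<noteq> 0" using assms(2) by (auto simp: vec_eq_iff)
  define k where "k = x $ j / y $ j"
  have "e (y $ j) \<noteq> 0" using j e_eq_0_iff by blast
  then have r: "r = e k"
    using e_divide[OF j] eq[of j] unfolding k_def by (metis nonzero_mult_div_cancel_right)
  have "e (x $ i) = e (k * y $ i)" for i
    by (metis r eq e_mult)
  then have "x $ i = k * y $ i" for i using e_eq_iff by blast
  then have "x = k *s y" by (simp add: vec_eq_iff)
  then show ?thesis by blast
qed

lemma c_eq_0_iff: "c x = 0 \<longleftrightarrow> x = 0"
proof
  assume "c x = 0"
  then have "(\<chi> i. e (x $ i)) = 0" unfolding c_def by (rule C_inj)
  then show "x = 0" by (simp add: vec_eq_iff e_eq_0_iff)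
qed (use c_scale[of 0 0] e_0 in simp)

lemma c_eq_iff: "c x = c y \<longleftrightarrow> x = y"
  using c_add[of "x - y" y] c_eq_0_iff[of "x - y"] by auto

lemma subspace_line: "i < s \<Longrightarrow> vec.subspace (L i)"
  using line by (simp add: proj_line_def)

lemma subspace_axis_space: "vec.subspace axis_space"
  by (auto simp: vec.subspace_def axis_space_def c_add c_scale c_eq_0_iff[THEN iffD2])

lemma t_neq: "\<lbrakk>i < s; j < s; i \<noteq> j\<rbrakk> \<Longrightarrow> t i \<noteq> t j"
  using t_inj by (auto dest: inj_onD)

lemma lines_disjoint:
  assumes "i < s" "j < s" "i \<noteq> j"
  shows "L i \<inter> L j \<subseteq> {0}"
proof
  fix x assume "x \<in> L i \<inter> L j"
  then have *: "c x $ 4 = t i * c x $ 3" "c x $ 2 = t i * c x $ 1 + u i * c x $ 3"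
    "c x $ 4 = t j * c x $ 3" "c x $ 2 = t j * c x $ 1 + u j * c x $ 3"
    using mem_line assms by auto
  then have 3: "c x $ 3 = 0" using t_neq[OF assms] by auto
  then have "c x $ 1 = 0" using * t_neq[OF assms] by auto
  then have "c x = 0" using * 3 by (intro vec4_eqI) auto
  then show "x \<in> {0}" by (simp add: c_eq_0_iff)
qed

lemma fixed_iff:
  assumes "i < s" "x \<in> L i"
  shows "vec.span {x} \<in> proj_points axis_space \<longleftrightarrow> x \<noteq> 0 \<and> c x $ 3 = 0"
proof
  assume "vec.span {x} \<in> proj_points axis_space"
  then have "vec.span {x} \<subseteq> axis_space" "vec.dim {x} = 1" by (auto simp: proj_points_def)
  then show "x \<noteq> 0 \<and> c x $ 3 = 0"
    using vec.span_base[of x "{x}"] by (auto simp: axis_space_def split: if_splits)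
next
  assume x: "x \<noteq> 0 \<and> c x $ 3 = 0"
  then have "x \<in> axis_space" using mem_line[OF assms(1), of x] assms(2) by (simp add: axis_space_def)
  then show "vec.span {x} \<in> proj_points axis_space"
    using x by (intro proj_points_span subspace_axis_space) auto
qed

lemma z_span: "x \<noteq> 0 \<Longrightarrow> z (vec.span {x}) = c x $ 1 / c x $ 3"
proof -
  assume x: "x \<noteq> 0"
  define y where "y = (SOME y. y \<in> vec.span {x} \<and> y \<noteq> 0)"
  have "y \<in> vec.span {x} \<and> y \<noteq> 0"
    unfolding y_def by (rule someI_ex) (use x vec.span_base[of x "{x}"] in auto)
  then obtain k where k: "y = k *s x" "k \<noteq> 0" by (auto simp: vec.span_singleton)
  have "z (vec.span {x}) = c y $ 1 / c y $ 3" unfolding z_def Let_def y_def by (rule refl)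
  also have "\<dots> = c x $ 1 / c x $ 3" using k e_eq_0_iff[of k] by (simp add: c_scale)
  finally show "z (vec.span {x}) = c x $ 1 / c x $ 3" .
qed

text \<open>Split x = y + w with y on \<open>L j\<close> and w on \<open>L k\<close>, and impose the
  equations of \<open>L k\<close> on x - y. The first gives (t j - t k) y3 = (t i - t k) x3, the
  second then determines y1.\<close>

lemma line_step:
  assumes ijk: "i < s" "j < s" "k < s" "j \<noteq> i" "k \<noteq> i" "k \<noteq> j" and x: "x \<in> L i" "x \<noteq> 0"
  obtains y where "y \<in> L j" "y \<noteq> 0" "line_map L i j k (vec.span {x}) = vec.span {y}"
    "c y $ 3 = 0 \<longleftrightarrow> c x $ 3 = 0"
    "c x $ 3 \<noteq> 0 \<longrightarrow> c y $ 1 / c y $ 3 = c x $ 1 / c x $ 3 + \<delta> i j k"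
proof -
  obtain y w where yw: "y \<in> L j" "w \<in> L k" "x = y + w"

    by (rule complementary_lines_sum[OF line[OF ijk(2)] line[OF ijk(3)] lines_disjoint])
      (use ijk in auto)
  have y0: "y \<noteq> 0"
  proof
    assume "y = 0"
    then show False using lines_disjoint[of i k] ijk yw x by auto
  qed
  have map: "line_map L i j k (vec.span {x}) = vec.span {y}"
    using yw x ijk lines_disjoint[of j k] unfolding yw(3) by (intro line_map_span subspace_line) auto
  define a where "a = t i - t k"
  define b where "b = t j - t k"
  have ab: "a \<noteq> 0" "b \<noteq> 0" using t_neq ijk by (auto simp: a_def b_def)
  have cw: "c w $ m = c x $ m - c y $ m" for m using yw(3) by (simp add: c_add)
  have mx: "c x $ 4 = t i * c x $ 3" "c x $ 2 = t i * c x $ 1 + u i * c x $ 3"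
    and my: "c y $ 4 = t j * c y $ 3" "c y $ 2 = t j * c y $ 1 + u j * c y $ 3"
    and mw: "c w $ 4 = t k * c w $ 3" "c w $ 2 = t k * c w $ 1 + u k * c w $ 3"
    using mem_line[OF ijk(1)] mem_line[OF ijk(2)] mem_line[OF ijk(3)] x(1) yw(1,2) by blast+
  have 4: "t i * c x $ 3 = t j * c y $ 3 + t k * (c x $ 3 - c y $ 3)"
    using mw(1) unfolding cw mx(1) my(1) by (simp add: algebra_simps)
  then have 3: "b * c y $ 3 = a * c x $ 3" by (simp add: a_def b_def algebra_simps)
  have "t i * c x $ 1 + u i * c x $ 3 = (t j * c y $ 1 + u j * c y $ 3) +
      (t k * (c x $ 1 - c y $ 1) + u k * (c x $ 3 - c y $ 3))"
    using mw(2) unfolding cw mx(2) my(2) by (simp add: algebra_simps)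
  then have 1: "b * c y $ 1 = a * c x $ 1 + (u i - u k) * c x $ 3 - (u j - u k) * c y $ 3"
    by (simp add: a_def b_def algebra_simps)
  have iff: "c y $ 3 = 0 \<longleftrightarrow> c x $ 3 = 0" using 3 ab by auto
  have "c y $ 1 / c y $ 3 = c x $ 1 / c x $ 3 + \<delta> i j k" if "c x $ 3 \<noteq> 0"
  proof -
    have y3: "c y $ 3 \<noteq> 0" using iff that by simp
    \<comment> \<open>With denominator \<open>b * c y $ 3\<close>, which equals
      \<open>a * c x $ 3\<close>, each summand can be cancelled in the form that suits it.\<close>
    have "c y $ 1 / c y $ 3 = (b * c y $ 1) / (b * c y $ 3)" using ab by simp
    also have "\<dots> = (a * c x $ 1) / (b * c y $ 3) + ((u i - u k) * c x $ 3) / (b * c y $ 3) -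
        ((u j - u k) * c y $ 3) / (b * c y $ 3)"
      unfolding 1 by (simp add: add_divide_distrib diff_divide_distrib)
    also have "((u j - u k) * c y $ 3) / (b * c y $ 3) = (u j - u k) / b" using y3 by simp
    also have "((u i - u k) * c x $ 3) / (b * c y $ 3) = (u i - u k) / a" unfolding 3 using that by simp
    also have "(a * c x $ 1) / (b * c y $ 3) = c x $ 1 / c x $ 3" unfolding 3 using ab by simp
    finally show ?thesis by (simp add: \<delta>_def a_def b_def)
  qed
  then show thesis using that yw y0 map iff by blast
qed

text \<open>Otherwise all vectors of the line would have coordinates proportional to (1, t i, 0, 0),
  and by descent the line would have dimension at most 1.\<close>

lemma affine_vector:
  assumes "i < s"
  obtains x where "x \<in> L i" "c x $ 3 \<noteq> 0"
proof (rule ccontr)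
  note witness = that
  assume "\<not> thesis"
  then have 3: "c x $ 3 = 0" if x: "x \<in> L i" for x using witness[OF x] by blast
  define v :: "'f ^ 4" where "v = (\<chi> m. if m = 1 then 1 else if m = 2 then t i else 0)"
  have *: "c x = c x $ 1 *s v" if "x \<in> L i" for x
    using mem_line[OF assms, of x] that 3[OF that] unfolding v_def
    by (intro vec4_eqI) (simp_all add: mult.commute)
  have "\<not> L i \<subseteq> {0}"
  proof
    assume "L i \<subseteq> {0}"
    then have "vec.dim (L i) = 0" by (simp only: vec.dim_eq_0)
    then show False using line[OF assms] unfolding proj_line_def by linarith
  qed
  then obtain y where y: "y \<in> L i" "y \<noteq> 0" by auto
  define k where "k = c y $ 1"
  have cy: "c y = k *s v" using *[OF y(1)] by (simp only: k_def)
  have k: "k \<noteq> 0" using cy c_eq_0_iff[of y] y(2) by (metis vec.scale_zero_left)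
  have "x \<in> vec.span {y}" if "x \<in> L i" for x
  proof -
    have "c x = (c x $ 1 / k) *s c y"
      unfolding cy using k *[OF that] by (metis nonzero_eq_divide_eq vector_smult_assoc)
    then show ?thesis using c_eq_scale[of x _ y] y by (auto simp: vec.span_singleton)
  qed
  then have "vec.dim (L i) \<le> vec.dim (vec.span {y})" by (intro vec.dim_subset) auto
  then show False using line[OF assms] by (simp add: proj_line_def split: if_splits)
qed

lemma nontrivial_loop_exists:
  "\<exists>i j k l. i < s \<and> j < s \<and> k < s \<and> l < s \<and> j \<noteq> i \<and> k \<noteq> i \<and> k \<noteq> j \<and>
    l \<noteq> i \<and> l \<noteq> j \<and> \<delta> i j k + \<delta> j i l \<noteq> 0"
proof (rule ccontr)
  assume no: "\<not> ?thesis"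
  have const: "\<delta> 0 1 k = \<delta> 0 1 2" if "k < s" "k \<noteq> 0" "k \<noteq> 1" for k
  proof -
    have "\<delta> 0 1 k + \<delta> 1 0 2 = 0"
    proof (rule ccontr)
      assume "\<delta> 0 1 k + \<delta> 1 0 2 \<noteq> 0"
      then have "\<exists>i j k l. i < s \<and> j < s \<and> k < s \<and> l < s \<and> j \<noteq> i \<and> k \<noteq> i \<and> k \<noteq> j \<and>
        l \<noteq> i \<and> l \<noteq> j \<and> \<delta> i j k + \<delta> j i l \<noteq> 0"
        using that four_le by (intro exI[of _ 0] exI[of _ 1] exI[of _ k] exI[of _ 2]) auto
      then show False using no by blast
    qed
    then show ?thesis using \<delta>_flip[of 1 0 2] by simp
  qed
  have "\<exists>\<alpha> \<beta> \<gamma>. \<forall>i<s. u i = \<alpha> + \<beta> * t i + \<gamma> * (t i)\<^sup>2"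
  proof (rule quadratic_through_points[OF t_inj])
    show "2 \<le> s" using four_le by simp
    show "(u 0 - u k) / (t 0 - t k) - (u 1 - u k) / (t 1 - t k) = \<delta> 0 1 2"
      if "k < s" "k \<noteq> 0" "k \<noteq> 1" for k
      using const[OF that] unfolding \<delta>_def[of 0 1 k] .
  qed
  then show False using not_quadratic by blast
qed

end

section \<open>Points of the lines and the translation axioms\<close>

context line_coordinates begin

text \<open>On \<open>L i\<close> coordinates 2 and 4 are linear in coordinates 1 and 3, so a single
  determinant decides proportionality.\<close>

lemma line_vectors_proportional:
  assumes "i < s" "x \<in> L i" "y \<in> L i" "y \<noteq> 0" and eq: "c x $ 1 * c y $ 3 = c y $ 1 * c x $ 3"
  shows "\<exists>k. x = k *s y"
proof -
  have mx: "c x $ 4 = t i * c x $ 3" "c x $ 2 = t i * c x $ 1 + u i * c x $ 3"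
    and my: "c y $ 4 = t i * c y $ 3" "c y $ 2 = t i * c y $ 1 + u i * c y $ 3"
    using mem_line[OF assms(1)] assms(2,3) by blast+
  have "\<exists>r. c x $ 1 = r * c y $ 1 \<and> c x $ 3 = r * c y $ 3"
  proof (cases "c y $ 3 = 0")
    case True
    have "c y $ 1 \<noteq> 0"
    proof
      assume "c y $ 1 = 0"
      then have "c y = 0" using True my by (intro vec4_eqI) simp_all
      then show False using assms(4) by (simp add: c_eq_0_iff)
    qed
    then show ?thesis using eq True by (intro exI[of _ "c x $ 1 / c y $ 1"]) simp
  next
    case False
    then show ?thesis using eq by (intro exI[of _ "c x $ 3 / c y $ 3"]) (simp add: field_simps)
  qed
  then obtain r where r: "c x $ 1 = r * c y $ 1" "c x $ 3 = r * c y $ 3" by blast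
  have "c x = r *s c y"
    by (rule vec4_eqI) (simp_all add: r mx my algebra_simps)
  then show ?thesis using c_eq_scale assms(4) by blast
qed

lemma point_vector:
  assumes "i < s" "p \<in> proj_points (L i)"
  obtains x where "x \<in> L i" "x \<noteq> 0" "p = vec.span {x}"
    "p \<in> proj_points axis_space \<longleftrightarrow> c x $ 3 = 0" "z p = c x $ 1 / c x $ 3"
proof -
  obtain x where x: "x \<noteq> 0" "x \<in> L i" "p = vec.span {x}" using proj_pointsE[OF assms(2)] .
  then show thesis using that[of x] fixed_iff[OF assms(1) x(2)] z_span[OF x(1)] by blast
qed

lemma fixed_point_vector:
  assumes "i < s" "p \<in> proj_points (L i)" "p \<in> proj_points axis_space"
  obtains x where "x \<in> L i" "x \<noteq> 0" "p = vec.span {x}" "c x $ 3 = 0"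
proof -
  obtain x where "x \<in> L i" "x \<noteq> 0" "p = vec.span {x}" "p \<in> proj_points axis_space \<longleftrightarrow> c x $ 3 = 0"
    using point_vector[OF assms(1,2)] .
  then show thesis using that assms(3) by blast
qed

lemma affine_point_vector:
  assumes "i < s" "p \<in> proj_points (L i)" "p \<notin> proj_points axis_space"
  obtains x where "x \<in> L i" "x \<noteq> 0" "p = vec.span {x}" "c x $ 3 \<noteq> 0" "z p = c x $ 1 / c x $ 3"
proof -
  obtain x where "x \<in> L i" "x \<noteq> 0" "p = vec.span {x}" "p \<in> proj_points axis_space \<longleftrightarrow> c x $ 3 = 0"
    "z p = c x $ 1 / c x $ 3"
    using point_vector[OF assms(1,2)] .
  then show thesis using that assms(3) by blast
qed

lemma line_step_point:
  assumes ijk: "i < s" "j < s" "k < s" "j \<noteq> i" "k \<noteq> i" "k \<noteq> j" and p: "p \<in> proj_points (L i)"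
  shows "line_map L i j k p \<in> proj_points (L j)"
    and "line_map L i j k p \<in> proj_points axis_space \<longleftrightarrow> p \<in> proj_points axis_space"
    and "p \<notin> proj_points axis_space \<Longrightarrow> z (line_map L i j k p) = z p + \<delta> i j k"
proof -
  obtain x where x: "x \<in> L i" "x \<noteq> 0" "p = vec.span {x}"
    "p \<in> proj_points axis_space \<longleftrightarrow> c x $ 3 = 0" "z p = c x $ 1 / c x $ 3"
    using point_vector[OF ijk(1) p] .
  obtain y where y: "y \<in> L j" "y \<noteq> 0" "line_map L i j k (vec.span {x}) = vec.span {y}"
    "c y $ 3 = 0 \<longleftrightarrow> c x $ 3 = 0"
    "c x $ 3 \<noteq> 0 \<longrightarrow> c y $ 1 / c y $ 3 = c x $ 1 / c x $ 3 + \<delta> i j k"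
    using line_step[OF ijk x(1,2)] .
  show "line_map L i j k p \<in> proj_points (L j)"
    unfolding x(3) y(3) by (rule proj_points_span[OF subspace_line[OF ijk(2)] y(1,2)])
  show "line_map L i j k p \<in> proj_points axis_space \<longleftrightarrow> p \<in> proj_points axis_space"
    using x(4) y(4) fixed_iff[OF ijk(2) y(1)] y(2) unfolding x(3) y(3) by blast
  show "z (line_map L i j k p) = z p + \<delta> i j k" if "p \<notin> proj_points axis_space"
    using x(4,5) y(5) z_span[OF y(2)] that unfolding x(3) y(3) by simp
qed

sublocale translation_config s L "proj_points axis_space" z \<delta>
proof
  show "3 \<le> s" using four_le by simp
  show "proj_points (L i) \<inter> proj_points (L j) = {}" if "i < s" "j < s" "i \<noteq> j" for i j
    using proj_points_Int_empty_iff[OF subspace_line[OF that(1)] subspace_line[OF that(2)]]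
      lines_disjoint[OF that] by blast
  show "\<exists>p. p \<in> proj_points (L i) \<and> p \<notin> proj_points axis_space" if i: "i < s" for i
  proof -
    obtain x where x: "x \<in> L i" "c x $ 3 \<noteq> 0" using affine_vector[OF i] .
    then have "x \<noteq> 0" using c_eq_0_iff[of x] by auto
    then show ?thesis
      using proj_points_span[OF subspace_line[OF i] x(1)] fixed_iff[OF i x(1)] x(2) by blast
  qed
  show "p = q" if i: "i < s" and p: "p \<in> proj_points (L i)" and q: "q \<in> proj_points (L i)"
    and fixed: "p \<in> proj_points axis_space" "q \<in> proj_points axis_space" for i p q
  proof -
    obtain x where x: "x \<in> L i" "x \<noteq> 0" "p = vec.span {x}" "c x $ 3 = 0"
      using fixed_point_vector[OF i p fixed(1)] .
    obtain y where y: "y \<in> L i" "y \<noteq> 0" "q = vec.span {y}" "c y $ 3 = 0"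
      using fixed_point_vector[OF i q fixed(2)] .
    obtain k where "x = k *s y" using line_vectors_proportional[OF i x(1) y(1,2)] x(4) y(4) by auto
    then show ?thesis unfolding x(3) y(3) using x(2) by (rule span_singleton_eqI)
  qed
  show "p = q" if i: "i < s" and p: "p \<in> proj_points (L i)" and q: "q \<in> proj_points (L i)"
    and affine: "p \<notin> proj_points axis_space" "q \<notin> proj_points axis_space" and z: "z p = z q" for i p q
  proof -
    obtain x where x: "x \<in> L i" "x \<noteq> 0" "p = vec.span {x}" "c x $ 3 \<noteq> 0" "z p = c x $ 1 / c x $ 3"
      using affine_point_vector[OF i p affine(1)] .
    obtain y where y: "y \<in> L i" "y \<noteq> 0" "q = vec.span {y}" "c y $ 3 \<noteq> 0" "z q = c y $ 1 / c y $ 3"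
      using affine_point_vector[OF i q affine(2)] .
    have "c x $ 1 * c y $ 3 = c y $ 1 * c x $ 3" using x(4,5) y(4,5) z by (simp add: frac_eq_eq)
    then obtain k where "x = k *s y" using line_vectors_proportional[OF i x(1) y(1,2)] by auto
    then show ?thesis unfolding x(3) y(3) using x(2) by (rule span_singleton_eqI)
  qed
  show "\<delta> j i k = - \<delta> i j k" for i j k by (rule \<delta>_flip)
  show "line_map L i j k p \<in> proj_points (L j)"
    if "i < s" "j < s" "k < s" "j \<noteq> i" "k \<noteq> i" "k \<noteq> j" "p \<in> proj_points (L i)" for i j k p
    by (rule line_step_point(1)[OF that])
  show "line_map L i j k p \<in> proj_points axis_space \<longleftrightarrow> p \<in> proj_points axis_space"
    if "i < s" "j < s" "k < s" "j \<noteq> i" "k \<noteq> i" "k \<noteq> j" "p \<in> proj_points (L i)" for i j k p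
    by (rule line_step_point(2)[OF that])
  show "z (line_map L i j k p) = z p + \<delta> i j k"
    if "i < s" "j < s" "k < s" "j \<noteq> i" "k \<noteq> i" "k \<noteq> j" "p \<in> proj_points (L i)"
      "p \<notin> proj_points axis_space" for i j k p
    by (rule line_step_point(3)[OF that])
qed (rule nontrivial_loop_exists)

text \<open>The shear is 1 + \<open>N\<close> in coordinates over the larger field, and it has to
  preserve rational vectors. This can be checked on two skew lines, which span the space. On a line,
  \<open>N\<close> kills the rational point on the axis and sends an affine rational vector to a
  rational multiple of that point.\<close>

lemma translation_matrix:
  assumes fixed: "\<And>i. i < s \<Longrightarrow> \<exists>o'. o' \<in> proj_points (L i) \<and> o' \<in> proj_points axis_space"
    and i: "i < s"
    and p: "p \<in> proj_points (L i)" "p \<notin> proj_points axis_space"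
    and q: "q \<in> proj_points (L i)" "q \<notin> proj_points axis_space"
  shows "\<exists>M :: 'a ^ 4 ^ 4. invertible M \<and> (\<forall>l<s. \<forall>r\<in>proj_points (L l). r \<notin> proj_points axis_space \<longrightarrow>
    (*v) M ` r \<in> proj_points (L l) \<and> (*v) M ` r \<notin> proj_points axis_space \<and>
    z ((*v) M ` r) = z r + (z q - z p))"
proof -
  define d where "d = z q - z p"
  define N :: "'f ^ 4 \<Rightarrow> 'f ^ 4" where
    "N v = (\<chi> m. if m = 1 then d * v $ 3 else if m = 2 then d * v $ 4 else 0)" for v
  have N: "N v $ 1 = d * v $ 3" "N v $ 2 = d * v $ 4" "N v $ 3 = 0" "N v $ 4 = 0" for v
    by (simp_all add: N_def)
  have N_add: "N (v + w) = N v + N w" for v w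
    by (rule vec4_eqI) (simp_all add: N algebra_simps)
  have N_scale: "N (k *s v) = k *s N v" for k v
    by (rule vec4_eqI) (simp_all add: N algebra_simps)
  have on_line: "\<exists>y. c y = N (c x)"
    if l: "l < s" and p': "p' \<in> P l" "p' \<notin> proj_points axis_space"
      and q': "q' \<in> P l" "q' \<notin> proj_points axis_space" and d': "z q' - z p' = d" and x: "x \<in> L l"
    for l p' q' x
  proof -
    obtain a where a: "a \<in> L l" "a \<noteq> 0" "p' = vec.span {a}" "c a $ 3 \<noteq> 0" "z p' = c a $ 1 / c a $ 3"
      using affine_point_vector[OF l p'] .
    obtain b where b: "b \<in> L l" "b \<noteq> 0" "q' = vec.span {b}" "c b $ 3 \<noteq> 0" "z q' = c b $ 1 / c b $ 3"
      using affine_point_vector[OF l q'] .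
    obtain o' where o': "o' \<in> P l" "o' \<in> proj_points axis_space" using fixed[OF l] by blast
    obtain r where r: "r \<in> L l" "r \<noteq> 0" "o' = vec.span {r}" "c r $ 3 = 0"
      using fixed_point_vector[OF l o'] .
    have indep: "a \<noteq> k *s r" for k using a(4) r(4) by (auto simp: c_scale)
    have mr: "c r $ 4 = 0" "c r $ 2 = t l * c r $ 1" and ma: "c a $ 4 = t l * c a $ 3"
      using mem_line[OF l, of r] mem_line[OF l, of a] r a(1) by auto
    \<comment> \<open>\<open>k\<close> and \<open>m\<close> are rational. Comparing coordinates 1
      and 3 expresses \<open>d\<close> through their ratio, which makes \<open>N (c a)\<close> the
      coordinate vector of \<open>(m / k) *s r\<close>.\<close>
    obtain k m where km: "b = k *s a + m *s r" using proj_line_combination[OF line[OF l] a(1) r(1,2) indep b(1)] .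
    have cb: "c b $ 1 = e k * c a $ 1 + e m * c r $ 1" "c b $ 3 = e k * c a $ 3"
      by (simp_all add: km c_add c_scale r(4))
    have ek: "e k \<noteq> 0" using cb(2) b(4) by auto
    then have k: "k \<noteq> 0" using e_0 by auto
    have "d = (e m / e k) * c r $ 1 / c a $ 3"
      using ek a(4) unfolding d'[symmetric] a(5) b(5) cb by (simp add: field_simps)
    then have d3: "d * c a $ 3 = e (m / k) * c r $ 1" using a(4) k by (simp add: e_divide)
    have d3': "d * (t l * c a $ 3) = e (m / k) * (t l * c r $ 1)" using d3 by (metis mult.left_commute)
    define y where "y = (m / k) *s r"
    have Na: "N (c a) = c y"
      unfolding y_def by (rule vec4_eqI) (simp_all add: N c_scale r(4) mr ma d3 d3')
    have Nr: "N (c r) = 0" by (rule vec4_eqI) (simp_all add: N r(4) mr)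
    obtain k' m' where x': "x = k' *s a + m' *s r"
      using proj_line_combination[OF line[OF l] a(1) r(1,2) indep x] .
    have "N (c x) = c (k' *s y)"
      by (simp add: x' c_add c_scale N_add N_scale Na Nr)
    then show ?thesis by metis
  qed
  \<comment> \<open>The second line: the arrow \<open>g\<close> carries \<open>p\<close> and
    \<open>q\<close> to it and keeps the difference \<open>d\<close> of their coordinates.\<close>
  obtain j where j: "j < s" "j \<noteq> i"
  proof -
    show thesis using that[of 0] that[of 1] four_le by (cases "i = 0") auto
  qed
  obtain g where g: "g \<in> Hom i j" using hom_nonempty[OF i j(1)] by blast
  have gp: "g p \<in> P j" "g p \<notin> proj_points axis_space" and gq: "g q \<in> P j" "g q \<notin> proj_points axis_space"
    using hom_mem[OF g] hom_fixed[OF g] p q by auto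
  have gd: "z (g q) - z (g p) = d" using hom_shift[OF g p] hom_shift[OF g q] by (simp add: d_def)
  have "\<exists>y. c y = c x + N (c x)" for x
  proof -
    obtain v w where vw: "v \<in> L i" "w \<in> L j" "x = v + w"
      by (rule complementary_lines_sum[OF line[OF i] line[OF j(1)] lines_disjoint[OF i j(1) j(2)[symmetric]]])
    obtain v' where "c v' = N (c v)" using on_line[OF i p q _ vw(1)] d_def by blast
    moreover obtain w' where "c w' = N (c w)" using on_line[OF j(1) gp gq gd vw(2)] by blast
    ultimately have "c (x + (v' + w')) = c x + N (c x)" by (simp add: c_add N_add vw(3))
    then show ?thesis by blast
  qed
  then obtain f where f: "\<And>x. c (f x) = c x + N (c x)" by metis
  have "f (x + y) = f x + f y" "f (k *s x) = k *s f x" for x y k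
    unfolding c_eq_iff[symmetric] by (simp_all add: f c_add c_scale N_add N_scale vector_add_ldistrib)
  then have lin: "Vector_Spaces.linear (*s) (*s) f"
    by (intro Vector_Spaces.linear_iff[THEN iffD2]) (auto intro: vec.vector_space_axioms)
  define M where "M = matrix f"
  have M: "M *v x = f x" for x unfolding M_def by (rule matrix_works[OF lin])
  have cM: "c (M *v x) $ 1 = c x $ 1 + d * c x $ 3" "c (M *v x) $ 2 = c x $ 2 + d * c x $ 4"
    "c (M *v x) $ 3 = c x $ 3" "c (M *v x) $ 4 = c x $ 4" for x
    by (simp_all add: M f N)
  have "inj ((*v) M)"
  proof (rule injI)
    fix x y assume eq: "M *v x = M *v y"
    have "c x = c y" using cM[of x] cM[of y] unfolding eq by (intro vec4_eqI) simp_all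
    then show "x = y" by (simp add: c_eq_iff)
  qed
  then have "invertible M" by (simp add: invertible_left_inverse matrix_left_invertible_injective)
  moreover have "(*v) M ` r \<in> P l \<and> (*v) M ` r \<notin> proj_points axis_space \<and> z ((*v) M ` r) = z r + (z q - z p)"
    if l: "l < s" and r: "r \<in> P l" "r \<notin> proj_points axis_space" for l r
  proof -
    obtain x where x: "x \<in> L l" "x \<noteq> 0" "r = vec.span {x}" "c x $ 3 \<noteq> 0" "z r = c x $ 1 / c x $ 3"
      using affine_point_vector[OF l r] .
    have img: "(*v) M ` r = vec.span {M *v x}"
      unfolding x(3) by (auto simp: vec.span_singleton vector_scalar_commute image_image)
    have "M *v x \<in> L l"
      using mem_line[OF l, of x] x(1) unfolding mem_line[OF l] cM by (simp add: algebra_simps)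
    moreover have "M *v x \<noteq> 0" using cM(3)[of x] x(4) c_eq_0_iff[of "M *v x"] by auto
    ultimately show ?thesis
      unfolding img using proj_points_span[OF subspace_line[OF l]] fixed_iff[OF l] z_span x(4,5) cM[of x]
      by (simp add: d_def add_divide_distrib)
  qed
  ultimately show ?thesis by blast
qed

end

section \<open>Coordinates from a transversal of multiplicity 2\<close>

text \<open>Otherwise the product of all X - a, plus 1, would be a nonconstant polynomial without a
  root.\<close>

lemma infinite_alg_closed: "infinite (UNIV :: 'f::alg_closed_field set)"
proof
  assume fin: "finite (UNIV :: 'f set)"
  define p :: "'f Polynomial.poly" where "p = (\<Prod>a\<in>UNIV. [:- a, 1:])"
  have deg: "Polynomial.degree p = card (UNIV :: 'f set)"
    unfolding p_def by (subst degree_prod_eq_sum_degree) auto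
  have "card (UNIV :: 'f set) > 0" using fin by (simp add: finite_UNIV_card_ge_0)
  then have "Polynomial.degree (p + 1) > 0" using deg by (subst degree_add_eq_left) auto
  then obtain x where "Polynomial.poly (p + 1) x = 0" using alg_closed_imp_poly_has_root by blast
  moreover have "Polynomial.poly p x = 0" using fin by (auto simp: p_def poly_prod)
  ultimately show False by simp
qed

section \<open>Quadratic forms and their polar forms\<close>

definition quad_polar :: "'a::field ^ 4 ^ 4 \<Rightarrow> 'a ^ 4 \<Rightarrow> 'a ^ 4 \<Rightarrow> 'a" where
  "quad_polar A x y = (\<Sum>k\<in>UNIV. quad_gradient A x $ k * y $ k)"

text \<open>Tangency speaks of the gradient, containment in a quadric of values of the form;
  polarization links the two in every characteristic.\<close>

lemma quad_polar_eq: "quad_polar A x y = quad_form A (x + y) - quad_form A x - quad_form A y"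
  by (simp add: quad_polar_def quad_form_def quad_gradient_def sum_4 algebra_simps)

lemma quad_form_scale: "quad_form A (k *s x) = k\<^sup>2 * quad_form A x"
  by (simp add: quad_form_def sum_4 algebra_simps power2_eq_square)

lemma quad_polar_sym: "quad_polar A x y = quad_polar A y x"
  by (simp add: quad_polar_eq add.commute)

lemma quad_polar_add_right: "quad_polar A x (y + w) = quad_polar A x y + quad_polar A x w"
  by (simp add: quad_polar_def algebra_simps sum.distrib)

lemma quad_polar_scale_right: "quad_polar A x (k *s y) = k * quad_polar A x y"
  by (simp add: quad_polar_def algebra_simps sum_distrib_left)

lemma quad_polar_add_left: "quad_polar A (x + y) w = quad_polar A x w + quad_polar A y w"
  by (simp add: quad_polar_sym[of A _ w] quad_polar_add_right)

lemma quad_polar_scale_left: "quad_polar A (k *s x) w = k * quad_polar A x w"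
  by (simp add: quad_polar_sym[of A _ w] quad_polar_scale_right)

lemma smooth_quadric_iff_polar:
  "smooth_quadric A \<longleftrightarrow> (\<forall>x. quad_form A x = 0 \<and> x \<noteq> 0 \<longrightarrow> (\<exists>y. quad_polar A x y \<noteq> 0))"
proof -
  have "quad_gradient A x \<noteq> 0 \<longleftrightarrow> (\<exists>y. quad_polar A x y \<noteq> 0)" for x
  proof
    assume "quad_gradient A x \<noteq> 0"
    then obtain k where "quad_gradient A x $ k \<noteq> 0" by (auto simp: vec_eq_iff)
    moreover have "quad_polar A x (axis k 1) = quad_gradient A x $ k"
      by (simp add: quad_polar_def axis_def if_distrib cong: if_cong)
    ultimately show "\<exists>y. quad_polar A x y \<noteq> 0" by metis
  qed (auto simp: quad_polar_def)
  then show ?thesis by (auto simp: smooth_quadric_def quadric_def)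
qed

text \<open>A rank-one matrix is a product of two linear forms, so a quadric given in other
  coordinates needs no symmetric matrix.\<close>

lemma quad_form_rank_one:
  fixes f g :: "'a::field ^ 4"
  shows "(\<Sum>i\<in>UNIV. \<Sum>j\<in>UNIV. f $ i * g $ j * x $ i * x $ j) =
    (\<Sum>i\<in>UNIV. f $ i * x $ i) * (\<Sum>j\<in>UNIV. g $ j * x $ j)"
  by (simp add: sum_product mult.assoc mult.left_commute)


text \<open>On x4 = t x3, x2 = t x1 + u x3 this form is x3^2 (u - \<alpha> - \<beta> t - \<gamma>
  t^2), so it vanishes on every line whose u is the quadratic value at t. Its part x2 x3 - x1 x4
  keeps it smooth in every characteristic.\<close>

lemma smooth_quadric_coordinates:
  fixes C :: "'f::alg_closed_field ^ 4 ^ 4"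
  assumes inj: "\<And>v. C *v v = 0 \<Longrightarrow> v = 0"
  obtains A where "smooth_quadric A"
    "\<And>v. quad_form A v = (C *v v) $ 2 * (C *v v) $ 3 - (C *v v) $ 1 * (C *v v) $ 4 -
      (\<alpha> * ((C *v v) $ 3)\<^sup>2 + \<beta> * ((C *v v) $ 3 * (C *v v) $ 4) + \<gamma> * ((C *v v) $ 4)\<^sup>2)"
proof -
  define A :: "'f ^ 4 ^ 4" where "A = (\<chi> i j. C $ 2 $ i * C $ 3 $ j - C $ 1 $ i * C $ 4 $ j -
    (\<alpha> * (C $ 3 $ i * C $ 3 $ j) + \<beta> * (C $ 3 $ i * C $ 4 $ j) + \<gamma> * (C $ 4 $ i * C $ 4 $ j)))"
  define Q where "Q W = W $ 2 * W $ 3 - W $ 1 * W $ 4 -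
    (\<alpha> * (W $ 3)\<^sup>2 + \<beta> * (W $ 3 * W $ 4) + \<gamma> * (W $ 4)\<^sup>2)" for W :: "'f ^ 4"
  have C: "(C *v v) $ m = (\<Sum>i\<in>UNIV. C $ m $ i * v $ i)" for v m
    by (simp add: matrix_vector_mult_def)
  have Q: "quad_form A v = Q (C *v v)" for v
  proof -
    have "quad_form A v =
        (\<Sum>i\<in>UNIV. \<Sum>j\<in>UNIV. C $ 2 $ i * C $ 3 $ j * v $ i * v $ j) -
        (\<Sum>i\<in>UNIV. \<Sum>j\<in>UNIV. C $ 1 $ i * C $ 4 $ j * v $ i * v $ j) -
        (\<alpha> * (\<Sum>i\<in>UNIV. \<Sum>j\<in>UNIV. C $ 3 $ i * C $ 3 $ j * v $ i * v $ j) +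
         \<beta> * (\<Sum>i\<in>UNIV. \<Sum>j\<in>UNIV. C $ 3 $ i * C $ 4 $ j * v $ i * v $ j) +
         \<gamma> * (\<Sum>i\<in>UNIV. \<Sum>j\<in>UNIV. C $ 4 $ i * C $ 4 $ j * v $ i * v $ j))"
      by (simp add: quad_form_def A_def algebra_simps sum.distrib sum_subtractf sum_distrib_left)
    then show ?thesis
      by (simp only: quad_form_rank_one flip: C) (simp add: Q_def power2_eq_square)
  qed
  have surj: "\<exists>v. C *v v = w" for w
  proof -
    have "inj ((*v) C)"
    proof (rule injI)
      fix x y assume "C *v x = C *v y"
      then have "C *v (x - y) = 0" by (simp add: matrix_vector_mult_diff_distrib)
      then show "x = y" using inj by fastforce
    qed
    then have "\<exists>B. B ** C = mat 1" by (simp add: matrix_left_invertible_injective)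
    then obtain B where "B ** C = mat 1" ..
    then have "C ** B = mat 1" by (simp add: matrix_left_right_inverse)
    then have "C *v (B *v w) = w" by (simp add: matrix_vector_mul_assoc)
    then show ?thesis by blast
  qed
  have "smooth_quadric A"
    unfolding smooth_quadric_iff_polar
  proof (intro allI impI, rule ccontr)
    fix x assume x: "quad_form A x = 0 \<and> x \<noteq> 0" and "\<nexists>y. quad_polar A x y \<noteq> 0"
    then have polar: "quad_polar A x y = 0" for y by blast
    define W where "W = C *v x"
    have 0: "Q (W + Y) - Q W - Q Y = 0" for Y
    proof -
      obtain y where y: "C *v y = Y" using surj by blast
      show ?thesis using polar[of y] by (simp add: quad_polar_eq Q matrix_vector_right_distrib W_def y)
    qed
    \<comment> \<open>Pairing with the four basis vectors gives, up to sign and terms in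
      \<open>W $ 3\<close> and \<open>W $ 4\<close>, the coordinates 4, 3, 2, 1 of
      \<open>W\<close>.\<close>
    have W4: "W $ 4 = 0" using 0[of "axis 1 1"] by (simp add: Q_def axis_def algebra_simps)
    have W3: "W $ 3 = 0" using 0[of "axis 2 1"] W4 by (simp add: Q_def axis_def algebra_simps)
    have W2: "W $ 2 = 0" using 0[of "axis 3 1"] W3 W4 by (simp add: Q_def axis_def algebra_simps)
    have W1: "W $ 1 = 0" using 0[of "axis 4 1"] W3 W4 by (simp add: Q_def axis_def algebra_simps)
    have "W = 0" using W1 W2 W3 W4 by (intro vec4_eqI) simp_all
    then show False using inj[of x] x by (simp add: W_def)
  qed
  then show thesis using that Q unfolding Q_def by blast
qed

lemma skew_lines_Int:
  assumes "skew_lines s L" "i < s" "j < s" "i \<noteq> j"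
  shows "L i \<inter> L j \<subseteq> {0}"
  using assms proj_points_Int_empty_iff[of "L i" "L j"] by (auto simp: skew_lines_def proj_line_def)

text \<open>
  The polar form of the quadric vanishes on \<open>T \<times> T\<close> and has no kernel in \<open>T\<close>, so it pairs \<open>T\<close>
  with the quotient by \<open>T\<close>; this pairing supplies the last two coordinates. The basis vector
  \<open>e2\<close> of \<open>T\<close> avoids all lines of the configuration, so that no parameter \<open>t i\<close> is infinite.
\<close>

lemma double_transversal_coordinates:
  fixes L :: "nat \<Rightarrow> ('f::alg_closed_field ^ 4) set"
  assumes skew: "skew_lines s L" and dt: "double_transversal s L T"
  obtains C :: "'f ^ 4 ^ 4" and t u :: "nat \<Rightarrow> 'f"
  where "\<forall>v. C *v v = 0 \<longrightarrow> v = 0" and "inj_on t {..<s}"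
    and "T = {v. (C *v v) $ 3 = 0 \<and> (C *v v) $ 4 = 0}"
    and "\<forall>i<s. \<forall>v. v \<in> L i \<longleftrightarrow> (C *v v) $ 4 = t i * (C *v v) $ 3 \<and>
      (C *v v) $ 2 = t i * (C *v v) $ 1 + u i * (C *v v) $ 3"
    and "\<not> (\<exists>\<alpha> \<beta> \<gamma>. \<forall>i<s. u i = \<alpha> + \<beta> * t i + \<gamma> * (t i)\<^sup>2)"
proof -
  have line: "proj_line (L i)" if "i < s" for i using skew that by (simp add: skew_lines_def)
  then have sub: "vec.subspace (L i)" if "i < s" for i using that by (simp add: proj_line_def)
  have T: "proj_line T" and meet: "proj_points (L i) \<inter> proj_points T \<noteq> {}" if "i < s" for i
    using dt that by (auto simp: double_transversal_def transversal_def)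
  obtain a b c A where abc: "a < s" "b < s" "c < s" "a \<noteq> b" "a \<noteq> c" "b \<noteq> c"
    and A: "smooth_quadric A" "L a \<subseteq> quadric A" "L b \<subseteq> quadric A" "L c \<subseteq> quadric A"
    and tangent: "\<And>i. i < s \<Longrightarrow> L i \<subseteq> quadric A \<or> tangent_at A (L i) (L i \<inter> T)"
    using dt unfolding double_transversal_def by blast
  have T: "proj_line T" by (rule T[OF abc(1)])
  then have subT: "vec.subspace T" by (simp add: proj_line_def)
  have "\<exists>x. x \<in> L i \<and> x \<in> T \<and> x \<noteq> 0" if i: "i < s" for i
  proof -
    obtain p where p: "p \<in> proj_points (L i)" "p \<in> proj_points T" using meet[OF i] by blast
    obtain x where x: "x \<noteq> 0" "x \<in> L i" "p = vec.span {x}" using proj_pointsE[OF p(1)] .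
    have "x \<in> p" unfolding x(3) by (rule vec.span_base) simp
    then show ?thesis using x p(2) by (auto simp: proj_points_def)
  qed
  then obtain p where p: "\<And>i. i < s \<Longrightarrow> p i \<in> L i \<and> p i \<in> T \<and> p i \<noteq> 0" by metis
  have p_indep: "p i \<noteq> k *s p j" if "i < s" "j < s" "i \<noteq> j" for i j k
  proof
    assume "p i = k *s p j"
    then have "p i \<in> L j" using p[OF that(2)] sub[OF that(2)] by (simp add: vec.subspace_scale)
    then show False using skew_lines_Int[OF skew that] p[OF that(1)] by blast
  qed
  define e1 where "e1 = p b"
  let ?B = "quad_polar A"
  have T_comb: "\<exists>k m. v = k *s p a + m *s p b" if "v \<in> T" for v
    using proj_line_combination[OF T, of "p a" "p b" v] p[OF abc(1)] p[OF abc(2)]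
      p_indep[OF abc(1,2,4)] that by metis
  have qp: "quad_form A (p a) = 0" "quad_form A (p b) = 0" "quad_form A (p c) = 0"
    using A p abc by (auto simp: quadric_def)
  \<comment> \<open>T has three distinct points on the quadric, so both coefficients of
    \<open>p c\<close> are nonzero while the form takes the value k m B(p a, p b) = 0 there. Hence T
    lies in the quadric.\<close>
  have Bab: "?B (p a) (p b) = 0"
  proof -
    obtain k m where km: "p c = k *s p a + m *s p b" using T_comb p[OF abc(3)] by blast
    have "k \<noteq> 0" using km p_indep[OF abc(3,2) abc(6)[symmetric], of m] by auto
    moreover have "m \<noteq> 0" using km p_indep[OF abc(3,1) abc(5)[symmetric], of k] by auto
    moreover have "k * (m * ?B (p a) (p b)) = 0"
      using qp quad_polar_eq[of A "k *s p a" "m *s p b"]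
      by (auto simp: km quad_form_scale quad_polar_scale_left quad_polar_scale_right)
    ultimately show ?thesis by simp
  qed
  have qT: "quad_form A v = 0" if v: "v \<in> T" for v
  proof -
    obtain k m where "v = k *s p a + m *s p b" using T_comb[OF v] by blast
    then show ?thesis
      using quad_polar_eq[of A "k *s p a" "m *s p b"] qp Bab
      by (simp add: quad_form_scale quad_polar_scale_left quad_polar_scale_right)
  qed
  have BT: "?B v w = 0" if "v \<in> T" "w \<in> T" for v w
    using that qT vec.subspace_add[OF subT that] by (simp add: quad_polar_eq)
  \<comment> \<open>Contained or tangent, \<open>L i\<close> lies in the tangent plane at its point
    on T; this is all that enters below.\<close>
  have Bp: "?B v w = 0" if i: "i < s" and v: "v \<in> L i" "v \<in> T" and w: "w \<in> L i" for i v w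
    using tangent[OF i]
  proof
    assume "L i \<subseteq> quadric A"
    then have "quad_form A v = 0" "quad_form A w = 0" "quad_form A (v + w) = 0"
      using v w vec.subspace_add[OF sub[OF i] v(1) w] by (auto simp: quadric_def)
    then show ?thesis by (simp add: quad_polar_eq)
  next
    assume "tangent_at A (L i) (L i \<inter> T)"
    then show ?thesis using v w unfolding tangent_at_def quad_polar_def by blast
  qed
  have nondeg: "\<exists>w. ?B v w \<noteq> 0" if "v \<in> T" "v \<noteq> 0" for v
    using A(1) qT that unfolding smooth_quadric_iff_polar by blast
  have L_neq_T: "\<not> T \<subseteq> L i" if i: "i < s" for i
  proof
    assume "T \<subseteq> L i"
    then have "p a \<in> L i" "p b \<in> L i" using p abc by auto
    then show False
      using skew_lines_Int[OF skew i abc(1)] skew_lines_Int[OF skew i abc(2)] p[OF abc(1)] p[OF abc(2)] abc(4) by blast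
  qed
  \<comment> \<open>If two values were excluded by the same line, it would contain
    \<open>p b\<close> and \<open>p a\<close>, hence T. So finitely many values are excluded from an
    infinite field.\<close>
  obtain \<kappa> where \<kappa>: "\<And>i. i < s \<Longrightarrow> p a + \<kappa> *s p b \<notin> L i"
  proof -
    have "finite {k. p a + k *s p b \<in> L i}" if i: "i < s" for i
    proof (rule ccontr)
      assume inf: "infinite {k. p a + k *s p b \<in> L i}"
      then obtain k where k: "p a + k *s p b \<in> L i" using infinite_imp_nonempty by blast
      obtain k' where k': "p a + k' *s p b \<in> L i" "k' \<noteq> k"
        using infinite_remove[OF inf, of k] infinite_imp_nonempty by blast
      have "(p a + k' *s p b) - (p a + k *s p b) \<in> L i" by (rule vec.subspace_diff[OF sub[OF i] k'(1) k])
      then have "(k' - k) *s p b \<in> L i" by (simp add: vector_sub_rdistrib)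
      then have "inverse (k' - k) *s ((k' - k) *s p b) \<in> L i" by (rule vec.subspace_scale[OF sub[OF i]])
      then have "(inverse (k' - k) * (k' - k)) *s p b \<in> L i" by (simp only: vector_smult_assoc)
      moreover have "inverse (k' - k) * (k' - k) = 1" using k'(2) by (intro left_inverse) simp
      ultimately have pb: "p b \<in> L i" by simp
      have "(p a + k *s p b) - k *s p b \<in> L i"
        by (rule vec.subspace_diff[OF sub[OF i] k vec.subspace_scale[OF sub[OF i] pb]])
      then have pa: "p a \<in> L i" by simp
      have "T \<subseteq> L i"
      proof
        fix v assume "v \<in> T"
        then obtain k m where "v = k *s p a + m *s p b" using T_comb by blast
        then show "v \<in> L i"
          using vec.subspace_add[OF sub[OF i] vec.subspace_scale[OF sub[OF i] pa] vec.subspace_scale[OF sub[OF i] pb]] by simp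
      qed
      then show False using L_neq_T[OF i] by blast
    qed
    then have "finite (\<Union>i<s. {k. p a + k *s p b \<in> L i})" by blast
    then obtain \<kappa> where "\<kappa> \<notin> (\<Union>i<s. {k. p a + k *s p b \<in> L i})"
      using infinite_alg_closed ex_new_if_finite by metis
    then show thesis using that by blast
  qed
  define e2 where "e2 = p a + \<kappa> *s p b"
  have e2_L: "e2 \<notin> L i" if "i < s" for i using \<kappa>[OF that] by (simp add: e2_def)
  have e_T: "e1 \<in> T" "e2 \<in> T"
    using p abc vec.subspace_add[OF subT _ vec.subspace_scale[OF subT]] by (auto simp: e1_def e2_def)
  have e1_0: "e1 \<noteq> 0" using p abc by (simp add: e1_def)
  have e_indep: "e2 \<noteq> k *s e1" for k
  proof
    assume "e2 = k *s e1"
    then have "p a = (k - \<kappa>) *s p b" by (simp add: e1_def e2_def vector_sub_rdistrib algebra_simps)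
    then show False using p_indep[OF abc(1,2,4)] by blast
  qed
  have e_comb: "\<exists>k m. v = k *s e1 + m *s e2" if "v \<in> T" for v
    using proj_line_combination[OF T e_T(2,1) e1_0 e_indep that] by (metis add.commute)
  \<comment> \<open>The point of \<open>L i\<close> on T has a nonzero \<open>e1\<close>
    coefficient, since \<open>e2\<close> avoids \<open>L i\<close>. Scaling that to 1 leaves the
    parameter.\<close>
  have "\<exists>t. e1 + t *s e2 \<in> L i" if i: "i < s" for i
  proof -
    obtain k m where km: "p i = k *s e1 + m *s e2" using e_comb p[OF i] by blast
    have "k \<noteq> 0"
    proof
      assume "k = 0"
      then have pi: "p i = m *s e2" "m \<noteq> 0" using km p[OF i] by auto
      then have "inverse m *s p i = e2" by (simp add: vector_smult_assoc)
      then show False using vec.subspace_scale[OF sub[OF i], of "p i" "inverse m"] p[OF i] e2_L[OF i] by simp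
    qed
    then have "inverse k *s p i = e1 + (m / k) *s e2"
      by (simp add: km vector_add_ldistrib vector_smult_assoc divide_inverse mult.commute)
    then show ?thesis using vec.subspace_scale[OF sub[OF i], of "p i" "inverse k"] p[OF i] by metis
  qed
  then obtain t where t: "\<And>i. i < s \<Longrightarrow> e1 + t i *s e2 \<in> L i" by metis
  define o' where "o' i = e1 + t i *s e2" for i
  have o_L: "o' i \<in> L i" if "i < s" for i using t[OF that] by (simp add: o'_def)
  have o_T: "o' i \<in> T" for i
    unfolding o'_def by (rule vec.subspace_add[OF subT e_T(1) vec.subspace_scale[OF subT e_T(2)]])
  have o_0: "o' i \<noteq> 0" for i
  proof
    assume "o' i = 0"
    then have e1: "e1 = (- t i) *s e2" by (simp add: o'_def eq_neg_iff_add_eq_0 vector_sneg_minus1[symmetric])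
    then have "t i \<noteq> 0" using e1_0 by auto
    then have "e2 = (- inverse (t i)) *s e1" unfolding e1 by (simp add: vector_smult_assoc)
    then show False using e_indep by blast
  qed
  have t_inj: "inj_on t {..<s}"
  proof (rule inj_onI, rule ccontr)
    fix i j assume ij: "i \<in> {..<s}" "j \<in> {..<s}" "t i = t j" "i \<noteq> j"
    then have "o' i \<in> L j" using o_L[of j] by (simp add: o'_def)
    then show False using skew_lines_Int[OF skew, of i j] ij o_L[of i] o_0[of i] by auto
  qed
  \<comment> \<open>\<open>g\<close> extends the coordinates of T arbitrarily to the whole space.
    Another extension would change \<open>u\<close> by a polynomial of degree at most 2 in
    \<open>t\<close>.\<close>
  obtain g :: "'f ^ 4 \<Rightarrow> 'f ^ 4" where g: "Vector_Spaces.linear (*s) (*s) g" "g e1 = axis 1 (1 :: 'f)" "g e2 = axis 2 1"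
  proof -
    have "e2 \<noteq> e1" using e_indep[of 1] by simp
    have indep: "vec.independent {e2, e1}"
      using e1_0 e_indep \<open>e2 \<noteq> e1\<close> by (simp add: vec.independent_insert vec.span_singleton image_iff)
    obtain g where "Vector_Spaces.linear (*s) (*s) g"
      "\<forall>x\<in>{e2, e1}. g x = (if x = e1 then axis 1 1 else axis 2 (1 :: 'f) :: 'f ^ 4)"
      using vec.linear_independent_extend[OF indep, of "\<lambda>x. if x = e1 then axis 1 1 else axis 2 1"] by blast
    then show thesis using that \<open>e2 \<noteq> e1\<close> by auto
  qed
  have g_add: "g (v + w) = g v + g w" and g_scale: "g (k *s v) = k *s g v" for v w k
    using g(1) by (simp_all add: Vector_Spaces.linear_iff)
  \<comment> \<open>The signs make x4 = t i x3 the tangent plane at the point \<open>o' i\<close>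
    (see \<open>polar_o\<close>).\<close>
  define h :: "'f ^ 4 \<Rightarrow> 'f ^ 4" where
    "h v = (\<chi> m. if m = 1 then g v $ 1 else if m = 2 then g v $ 2 else if m = 3 then - ?B e2 v else ?B e1 v)" for v
  have h: "h v $ 1 = g v $ 1" "h v $ 2 = g v $ 2" "h v $ 3 = - ?B e2 v" "h v $ 4 = ?B e1 v" for v
    by (simp_all add: h_def)
  have h_add: "h (v + w) = h v + h w" for v w
    by (rule vec4_eqI) (simp_all add: h g_add quad_polar_add_right)
  have h_scale: "h (k *s v) = k *s h v" for k v
    by (rule vec4_eqI) (simp_all add: h g_scale quad_polar_scale_right)
  have h_linear: "Vector_Spaces.linear (*s) (*s) h"
    by (intro Vector_Spaces.linear_iff[THEN iffD2]) (auto simp: h_add h_scale intro: vec.vector_space_axioms)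
  define C where "C = matrix h"
  have C: "C *v v = h v" for v unfolding C_def by (rule matrix_works[OF h_linear])
  have h_o: "h (o' i) $ 1 = 1" "h (o' i) $ 2 = t i" "h (o' i) $ 3 = 0" "h (o' i) $ 4 = 0" for i
    using BT[OF e_T(1) o_T] BT[OF e_T(2) o_T]
    by (simp_all add: h) (simp_all add: o'_def g_add g_scale g(2,3) axis_def)
  have polar_o: "?B (o' i) v = h v $ 4 - t i * h v $ 3" for i v
    by (simp add: o'_def h quad_polar_add_left quad_polar_scale_left)
  have T_eq: "T = {v. h v $ 3 = 0 \<and> h v $ 4 = 0}"
  proof (intro equalityI subsetI CollectI)
    fix v assume "v \<in> T"
    then show "h v $ 3 = 0 \<and> h v $ 4 = 0" using BT e_T by (simp add: h)
  next
    fix v assume "v \<in> {v. h v $ 3 = 0 \<and> h v $ 4 = 0}"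
    then have Bo: "?B (o' i) v = 0" for i by (simp add: polar_o)
    \<comment> \<open>If \<open>w\<close> is not a multiple of \<open>o' i\<close>, the two span
      \<open>L i\<close>. Then \<open>o' j\<close> is orthogonal to \<open>L i\<close>, and by
      \<open>Bp\<close> to \<open>L j\<close>, hence to everything, against smoothness along
      T.\<close>
    have in_T: "w \<in> T" if i: "i < s" "j < s" "i \<noteq> j" and w: "w \<in> L i" "?B (o' j) w = 0" for i j w
    proof (cases "\<exists>k. w = k *s o' i")
      case True
      then show ?thesis using vec.subspace_scale[OF subT o_T] by blast
    next
      case False
      have "?B (o' j) x = 0" for x
      proof -
        obtain y z where yz: "y \<in> L i" "z \<in> L j" "x = y + z"
          by (rule complementary_lines_sum[OF line[OF i(1)] line[OF i(2)] skew_lines_Int[OF skew i]])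
        obtain k m where km: "y = k *s w + m *s o' i"
          using proj_line_combination[OF line[OF i(1)] w(1) o_L[OF i(1)] o_0 _ yz(1)] False by metis
        have "?B (o' j) y = 0" using w(2) BT[OF o_T o_T] by (simp add: km quad_polar_add_right quad_polar_scale_right)
        moreover have "?B (o' j) z = 0" by (rule Bp[OF i(2) o_L[OF i(2)] o_T yz(2)])
        ultimately show ?thesis by (simp add: yz(3) quad_polar_add_right)
      qed
      then show ?thesis using nondeg[OF o_T o_0] by blast
    qed
    \<comment> \<open>By \<open>Bp\<close> each part is orthogonal to the point of its own line, so
      orthogonality of the sum to both points gives the crossed relations that \<open>in_T\<close>
      asks for.\<close>
    obtain y w where yw: "y \<in> L a" "w \<in> L b" "v = y + w"
      by (rule complementary_lines_sum[OF line[OF abc(1)] line[OF abc(2)] skew_lines_Int[OF skew abc(1,2,4)]])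
    have "?B (o' a) y = 0" "?B (o' b) w = 0"
      using Bp abc o_L o_T yw by blast+
    then have "?B (o' b) y = 0" "?B (o' a) w = 0"
      using Bo[of a] Bo[of b] by (simp_all add: yw(3) quad_polar_add_right)
    then have "y \<in> T" "w \<in> T" using in_T abc yw by metis+
    then show "v \<in> T" unfolding yw(3) by (rule vec.subspace_add[OF subT])
  qed
  have h_inj: "v = 0" if hv: "h v = 0" for v
  proof -
    have "v \<in> T" using hv by (simp add: T_eq)
    then obtain k m where v: "v = k *s e1 + m *s e2" using e_comb by blast
    have "h v $ 1 = k" "h v $ 2 = m" by (simp_all add: h v g_add g_scale g(2,3) axis_def)
    then show ?thesis using hv v by simp
  qed
  have "\<exists>u. \<forall>v. v \<in> L i \<longleftrightarrow> h v $ 4 = t i * h v $ 3 \<and> h v $ 2 = t i * h v $ 1 + u * h v $ 3" if i: "i < s" for i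
  proof -
    have h4: "h v $ 4 = t i * h v $ 3" if "v \<in> L i" for v
      using polar_o[of i v] Bp[OF i o_L[OF i] o_T that] by simp
    \<comment> \<open>Otherwise the fourth coordinate vanishes too and \<open>L i\<close> is T,
      which contains \<open>e2\<close>.\<close>
    have "\<exists>v\<in>L i. h v $ 3 \<noteq> 0"
    proof (rule ccontr)
      assume "\<not> (\<exists>v\<in>L i. h v $ 3 \<noteq> 0)"
      then have "L i \<subseteq> T" using h4 unfolding T_eq by auto
      then have "L i = T"
        using line[OF i] T by (intro vec.subspace_dim_equal) (auto simp: proj_line_def)
      then show False using e2_L[OF i] e_T by simp
    qed
    then obtain x where x: "x \<in> L i" "h x $ 3 \<noteq> 0" by blast
    \<comment> \<open>\<open>o' i\<close> satisfies the second equation whatever \<open>u\<close>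
      is, so \<open>u\<close> is fitted to the other basis vector \<open>x\<close>.\<close>
    define u where "u = (h x $ 2 - t i * h x $ 1) / h x $ 3"
    have hx2: "h x $ 2 = t i * h x $ 1 + u * h x $ 3" using x(2) by (simp add: u_def)
    have indep: "x \<noteq> k *s o' i" for k using x(2) h_o(3)[of i] by (auto simp: h_scale)
    have "v \<in> L i \<longleftrightarrow> h v $ 4 = t i * h v $ 3 \<and> h v $ 2 = t i * h v $ 1 + u * h v $ 3" for v
    proof
      assume v: "v \<in> L i"
      obtain k m where km: "v = k *s x + m *s o' i"
        using proj_line_combination[OF line[OF i] x(1) o_L[OF i] o_0 indep v] .
      show "h v $ 4 = t i * h v $ 3 \<and> h v $ 2 = t i * h v $ 1 + u * h v $ 3"
        using h4[OF v] by (simp add: km h_add h_scale h_o hx2 algebra_simps)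
    next
      assume v: "h v $ 4 = t i * h v $ 3 \<and> h v $ 2 = t i * h v $ 1 + u * h v $ 3"
      \<comment> \<open>\<open>k\<close> and \<open>m\<close> match coordinates 3 and 1; the two
        equations then force the other two.\<close>
      define k where "k = h v $ 3 / h x $ 3"
      define m where "m = h v $ 1 - k * h x $ 1"
      define w where "w = k *s x + m *s o' i"
      have k: "k * h x $ 3 = h v $ 3" using x(2) by (simp add: k_def)
      have hw: "h w $ 1 = h v $ 1" "h w $ 3 = h v $ 3"
        by (simp_all add: w_def h_add h_scale h_o k) (simp add: m_def)
      have w: "w \<in> L i"
        unfolding w_def by (intro vec.subspace_add vec.subspace_scale sub[OF i] x(1) o_L[OF i])
      have "h w $ 2 = k * h x $ 2 + m * t i" by (simp add: w_def h_add h_scale h_o)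
      also have "\<dots> = t i * h v $ 1 + u * (k * h x $ 3)" unfolding hx2 m_def by (simp add: algebra_simps)
      finally have hw2: "h w $ 2 = h v $ 2" using v k by simp
      have "h w = h v" using hw hw2 h4[OF w] v by (intro vec4_eqI) simp_all
      then have "h (v + (- 1) *s w) = 0" unfolding h_add h_scale by simp
      then have "v + (- 1) *s w = 0" by (rule h_inj)
      then have "v = w" by (simp add: vector_sneg_minus1[symmetric])
      then show "v \<in> L i" using w by simp
    qed
    then show ?thesis by blast
  qed
  then obtain u where u: "\<And>i v. i < s \<Longrightarrow>
      v \<in> L i \<longleftrightarrow> h v $ 4 = t i * h v $ 3 \<and> h v $ 2 = t i * h v $ 1 + u i * h v $ 3" by metis
  have not_quadratic: "\<not> (\<exists>\<alpha> \<beta> \<gamma>. \<forall>i<s. u i = \<alpha> + \<beta> * t i + \<gamma> * (t i)\<^sup>2)"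
  proof
    assume "\<exists>\<alpha> \<beta> \<gamma>. \<forall>i<s. u i = \<alpha> + \<beta> * t i + \<gamma> * (t i)\<^sup>2"
    then obtain \<alpha> \<beta> \<gamma> where ui: "\<And>i. i < s \<Longrightarrow> u i = \<alpha> + \<beta> * t i + \<gamma> * (t i)\<^sup>2" by blast
    obtain A' where A': "smooth_quadric A'" "\<And>v. quad_form A' v = h v $ 2 * h v $ 3 - h v $ 1 * h v $ 4 -
        (\<alpha> * (h v $ 3)\<^sup>2 + \<beta> * (h v $ 3 * h v $ 4) + \<gamma> * (h v $ 4)\<^sup>2)"
      using smooth_quadric_coordinates[of C] h_inj unfolding C by metis
    have "L i \<subseteq> quadric A'" if i: "i < s" for i
    proof
      fix v assume "v \<in> L i"
      then have v: "h v $ 4 = t i * h v $ 3" "h v $ 2 = t i * h v $ 1 + u i * h v $ 3" using u[OF i] by auto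
      show "v \<in> quadric A'"
        unfolding quadric_def mem_Collect_eq A'(2) v ui[OF i] by (simp add: algebra_simps power2_eq_square)
    qed
    then show False using A'(1) dt unfolding double_transversal_def by blast
  qed
  show thesis
  proof (rule that[of C t u], unfold C)
    show "\<forall>v. h v = 0 \<longrightarrow> v = 0" using h_inj by blast
    show "inj_on t {..<s}" by (rule t_inj)
    show "T = {v. h v $ 3 = 0 \<and> h v $ 4 = 0}" by (rule T_eq)
    show "\<forall>i<s. \<forall>v. v \<in> L i \<longleftrightarrow> h v $ 4 = t i * h v $ 3 \<and> h v $ 2 = t i * h v $ 1 + u i * h v $ 3"
      using u by blast
    show "\<not> (\<exists>\<alpha> \<beta> \<gamma>. \<forall>i<s. u i = \<alpha> + \<beta> * t i + \<gamma> * (t i)\<^sup>2)" by (rule not_quadratic)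
  qed
qed

section \<open>Statements common to both fields\<close>

context line_coordinates begin

lemma line_group_additive:
  "\<forall>i<s. (\<exists>H. subgroup H (add_monoid (ring_of_type_algebra :: 'f ring)) \<and>
      line_group s L i \<cong> (add_monoid (ring_of_type_algebra :: 'f ring))\<lparr>carrier := H\<rparr>) \<and>
    comm_group (line_group s L i)"
  using line_group_iso_shifts subgroup_shifts comm_group_line_group by blast

text \<open>Phrased for a general embedding, so that it yields the orbit statements over the closure
  and over K alike. The rational points in \<open>fixed\<close> supply the orbit with s points and
  make the shear rational.\<close>

lemma orbits_off_axis:
  assumes fixed: "\<And>i. i < s \<Longrightarrow> \<exists>o'. o' \<in> proj_points (L i) \<and> o' \<in> proj_points axis_space"
  shows "{Z \<in> groupoid_orbit s L ` config_points s L. card Z = s} =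
      {proj_points axis_space \<inter> config_points s L} \<and>
    (\<forall>i<s. \<forall>j<s. \<forall>h \<in> groupoid_hom s L i j.
      faithful_action (line_group s L i) (proj_points (L j)) (line_action L i j h) \<and>
      (\<forall>p \<in> proj_points (L j) - proj_points axis_space.
         stabilizer (line_group s L i) (line_action L i j h) p = {\<one>\<^bsub>line_group s L i\<^esub>})) \<and>
    (\<forall>p \<in> config_points s L - proj_points axis_space.
     \<forall>q \<in> config_points s L - proj_points axis_space.
      (\<forall>i<s. {..<s} \<times> carrier (line_group s L i) \<approx> groupoid_orbit s L p) \<and>
      groupoid_orbit s L p \<approx> groupoid_orbit s L q \<and>
      {..<s} \<prec> groupoid_orbit s L q \<and>
      projectively_equivalent (groupoid_orbit s L p) (groupoid_orbit s L q)) \<and>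
    (\<forall>p \<in> config_points s L - proj_points axis_space.
      infinite (groupoid_orbit s L p) \<longleftrightarrow> CHAR('f) = 0)"
proof (intro conjI)
  show "{Z \<in> groupoid_orbit s L ` config_points s L. card Z = s} =
      {proj_points axis_space \<inter> config_points s L}"
    by (rule orbits_card_s[OF fixed])
  show "\<forall>i<s. \<forall>j<s. \<forall>h \<in> groupoid_hom s L i j.
      faithful_action (line_group s L i) (proj_points (L j)) (line_action L i j h) \<and>
      (\<forall>p \<in> proj_points (L j) - proj_points axis_space.
         stabilizer (line_group s L i) (line_action L i j h) p = {\<one>\<^bsub>line_group s L i\<^esub>})"
  proof (intro allI impI ballI conjI)
    fix i j h assume h: "h \<in> groupoid_hom s L i j"
    show "faithful_action (line_group s L i) (proj_points (L j)) (line_action L i j h)"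
      by (rule faithful_line_action[OF h])
    show "stabilizer (line_group s L i) (line_action L i j h) p = {\<one>\<^bsub>line_group s L i\<^esub>}"
      if "p \<in> proj_points (L j) - proj_points axis_space" for p
      using that by (intro stabilizer_affine[OF h]) auto
  qed
  show "\<forall>p \<in> config_points s L - proj_points axis_space.
     \<forall>q \<in> config_points s L - proj_points axis_space.
      (\<forall>i<s. {..<s} \<times> carrier (line_group s L i) \<approx> groupoid_orbit s L p) \<and>
      groupoid_orbit s L p \<approx> groupoid_orbit s L q \<and>
      {..<s} \<prec> groupoid_orbit s L q \<and>
      projectively_equivalent (groupoid_orbit s L p) (groupoid_orbit s L q)"
  proof (intro ballI, unfold Diff_iff, elim conjE, intro conjI allI impI)
    fix p q assume p: "p \<in> config_points s L" "p \<notin> proj_points axis_space"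
      and q: "q \<in> config_points s L" "q \<notin> proj_points axis_space"
    show orb: "{..<s} \<times> carrier (line_group s L i) \<approx> groupoid_orbit s L p" if "i < s" for i
      by (rule orbit_eqpoll[OF that p])
    have "0 < s" using four_le by simp
    from orb[OF this] orbit_eqpoll[OF this q]
    show "groupoid_orbit s L p \<approx> groupoid_orbit s L q" by (rule eqpoll_trans[OF eqpoll_sym])
    show "{..<s} \<prec> groupoid_orbit s L q" by (rule orbit_lesspoll[OF q])
    show "projectively_equivalent (groupoid_orbit s L p) (groupoid_orbit s L q)"
      by (rule orbits_projectively_equivalent[OF translation_matrix[OF fixed] p q])
  qed
  show "\<forall>p \<in> config_points s L - proj_points axis_space.
      infinite (groupoid_orbit s L p) \<longleftrightarrow> CHAR('f) = 0"
    using infinite_orbit_iff by simp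
qed

end

section \<open>Extension of scalars\<close>

definition extend_vec :: "'a::field ^ 4 \<Rightarrow> 'a alg_closure ^ 4" where
  "extend_vec x = (\<chi> i. to_ac (x $ i))"

lemma extend_scalars_eq: "extend_scalars V = vec.span (extend_vec ` V)"
  by (simp add: extend_scalars_def extend_vec_def)

lemma extend_vec_add: "extend_vec (x + y) = extend_vec x + extend_vec y"
  and extend_vec_scale: "extend_vec (k *s x) = to_ac k *s extend_vec x"
  and extend_vec_0: "extend_vec 0 = 0"
  by (simp_all add: extend_vec_def vec_eq_iff)

lemma inj_extend_vec: "inj extend_vec"
  by (rule injI) (simp add: extend_vec_def vec_eq_iff)

lemma extend_vec_span:
  assumes "x \<in> vec.span B"
  shows "extend_vec x \<in> vec.span (extend_vec ` B)"
  using assms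
proof (induction rule: vec.span_induct_alt)
  case base
  show ?case by (simp add: extend_vec_0 vec.span_zero)
next
  case (step k x y)
  then show ?case by (simp add: extend_vec_add extend_vec_scale vec.span_add vec.span_scale vec.span_base)
qed

text \<open>The standard basis vectors have entries 0 and 1 and so come from the small
  field.\<close>

lemma subspace_extend_vec_UNIV:
  assumes "vec.subspace S" "range extend_vec \<subseteq> S"
  shows "S = UNIV"
proof -
  have "cart_basis \<subseteq> S"
  proof
    fix v :: "'a alg_closure ^ 4" assume "v \<in> cart_basis"
    then obtain i where "v = axis i 1" by (auto simp: cart_basis_def)
    then have "v = extend_vec (axis i 1)" by (simp add: extend_vec_def axis_def vec_eq_iff)
    then show "v \<in> S" using assms(2) by blast
  qed
  then have "vec.span cart_basis \<subseteq> S" using assms(1) by (rule vec.span_minimal)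
  then show ?thesis by auto
qed

text \<open>Complete to a basis. The images span all rational vectors, hence everything, and a
  spanning set no larger than the dimension is independent.\<close>

lemma independent_extend_vec:
  assumes "vec.independent B"
  shows "vec.independent (extend_vec ` B)"
proof -
  obtain B' where B': "B \<subseteq> B'" "vec.independent B'" "UNIV \<subseteq> vec.span B'"
    by (rule vec.maximal_independent_subset_extend[OF subset_UNIV assms])
  have fin: "finite (extend_vec ` B')" by (intro finite_imageI vec.finiteI_independent[OF B'(2)])
  have "card (extend_vec ` B') = card B'"
    by (rule card_image[OF inj_on_subset[OF inj_extend_vec subset_UNIV]])
  also have "\<dots> = vec.dim (UNIV :: ('a ^ 4) set)"
    by (rule vec.basis_card_eq_dim[OF subset_UNIV B'(3,2)])
  also have "\<dots> = vec.dim (UNIV :: ('a alg_closure ^ 4) set)" by (simp only: vec_dim_card)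
  finally have card: "card (extend_vec ` B') \<le> vec.dim (UNIV :: ('a alg_closure ^ 4) set)" by simp
  have "range extend_vec \<subseteq> vec.span (extend_vec ` B')" using B'(3) extend_vec_span by blast
  then have span: "UNIV \<subseteq> vec.span (extend_vec ` B')"
    using subspace_extend_vec_UNIV[OF vec.subspace_span] by blast
  have "vec.independent (extend_vec ` B')"
    by (rule vec.card_le_dim_spanning[OF subset_UNIV span fin card])
  then show ?thesis by (rule vec.independent_mono) (use B'(1) in blast)
qed

lemma extend_scalars_basis:
  assumes "B \<subseteq> V" "V \<subseteq> vec.span B"
  shows "extend_scalars V = vec.span (extend_vec ` B)"
proof -
  have "extend_vec ` V \<subseteq> vec.span (extend_vec ` B)" using assms(2) extend_vec_span by blast
  then show ?thesis
    unfolding extend_scalars_eq using assms(1)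
    by (intro equalityI vec.span_minimal vec.subspace_span vec.span_mono) auto
qed

lemma proj_line_extend_scalars:
  assumes "proj_line V"
  shows "proj_line (extend_scalars V)"
proof -
  obtain B where B: "B \<subseteq> V" "vec.independent B" "V \<subseteq> vec.span B" "card B = vec.dim V"
    using vec.basis_exists[of V] by metis
  have "vec.dim (extend_scalars V) = card (extend_vec ` B)"
    unfolding extend_scalars_basis[OF B(1,3)] vec.dim_span
    by (rule vec.dim_eq_card_independent[OF independent_extend_vec[OF B(2)]])
  also have "\<dots> = 2"
    using B(4) assms card_image[OF inj_on_subset[OF inj_extend_vec subset_UNIV], of B]
    by (simp add: proj_line_def)
  finally show ?thesis by (simp add: proj_line_def extend_scalars_eq)
qed

text \<open>Extension adds no rational vectors: \<open>x\<close> outside \<open>V\<close> is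
  independent of a basis of \<open>V\<close>, and remains so.\<close>

lemma extend_vec_mem_iff:
  assumes "vec.subspace V"
  shows "extend_vec x \<in> extend_scalars V \<longleftrightarrow> x \<in> V"
proof
  assume "x \<in> V"
  then show "extend_vec x \<in> extend_scalars V" unfolding extend_scalars_eq by (intro vec.span_base imageI)
next
  assume ext: "extend_vec x \<in> extend_scalars V"
  obtain B where B: "B \<subseteq> V" "vec.independent B" "V \<subseteq> vec.span B"
    using vec.basis_exists[of V] by metis
  show "x \<in> V"
  proof (rule ccontr)
    assume x: "x \<notin> V"
    then have "x \<notin> vec.span B" using vec.span_minimal[OF B(1) assms] by blast
    then have "vec.independent (insert x B)" using B(2) by (rule vec.independent_insertI)
    then have "vec.independent (insert (extend_vec x) (extend_vec ` B))"
      using independent_extend_vec[of "insert x B"] by simp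
    moreover have "extend_vec x \<notin> extend_vec ` B"
      using x B(1) inj_extend_vec by (auto dest: injD)
    ultimately have "extend_vec x \<notin> vec.span (extend_vec ` B)"
      by (simp add: vec.independent_insert)
    then show False using ext extend_scalars_basis[OF B(1,3)] by simp
  qed
qed

text \<open>The sum of the extended lines contains all rational vectors, so it is the whole space,
  and the dimension formula leaves 0 for the intersection.\<close>

lemma extend_scalars_disjoint:
  assumes V: "proj_line V" and W: "proj_line W" and "V \<inter> W \<subseteq> {0}"
  shows "extend_scalars V \<inter> extend_scalars W \<subseteq> {0}"
proof -
  note V' = proj_line_extend_scalars[OF V] and W' = proj_line_extend_scalars[OF W]
  let ?S = "{y + w | y w. y \<in> extend_scalars V \<and> w \<in> extend_scalars W}"
  have sub: "vec.subspace (extend_scalars V)" "vec.subspace (extend_scalars W)"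
    using V' W' by (auto simp: proj_line_def)
  have "range extend_vec \<subseteq> ?S"
  proof
    fix v :: "'a alg_closure ^ 4" assume "v \<in> range extend_vec"
    then obtain x where x: "v = extend_vec x" by blast
    obtain y w where yw: "y \<in> V" "w \<in> W" "x = y + w" by (rule complementary_lines_sum[OF assms])
    have "extend_vec y \<in> extend_scalars V" "extend_vec w \<in> extend_scalars W"
      using yw V W by (simp_all add: extend_vec_mem_iff proj_line_def)
    then show "v \<in> ?S" unfolding x yw(3) extend_vec_add by blast
  qed
  then have "?S = UNIV" by (intro subspace_extend_vec_UNIV vec.subspace_sums sub)
  then have "vec.dim ?S = 4" by (simp add: card_cart_basis)
  then have "vec.dim (extend_scalars V \<inter> extend_scalars W) = 0"
    using vec.dim_sums_Int[OF sub] V' W' unfolding proj_line_def by linarith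
  then show ?thesis by (simp only: vec.dim_eq_0)
qed

lemma skew_lines_extend_scalars:
  assumes "skew_lines s L"
  shows "skew_lines s (extend_scalars \<circ> L)"
proof -
  have line: "proj_line (L i)" if "i < s" for i using assms that by (simp add: skew_lines_def)
  have "proj_points (extend_scalars (L i)) \<inter> proj_points (extend_scalars (L j)) = {}"
    if "i < s" "j < s" "i \<noteq> j" for i j
    using extend_scalars_disjoint[OF line line skew_lines_Int[OF assms that]] that
      proj_line_extend_scalars[OF line] by (subst proj_points_Int_empty_iff) (auto simp: proj_line_def)
  then show ?thesis using line by (auto simp: skew_lines_def proj_line_extend_scalars)
qed

text \<open>The group statements come from the coordinates alone, over either field. The orbit
  statements rely on the points on T: over the closure every line has one, over K this is ensured by
  T coming from \<open>T\<^sub>0\<close>.\<close>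

theorem corollary2p1p21:
  fixes L :: "nat \<Rightarrow> ('k::field ^ 4) set"
    and T :: "('k alg_closure ^ 4) set"
    and s :: nat
  assumes "s \<ge> 4"
    and "skew_lines s L"
    and "double_transversal s (extend_scalars \<circ> L) T"
  shows "(\<forall>i<s.
           (\<exists>H. subgroup H (add_monoid (ring_of_type_algebra :: 'k alg_closure ring)) \<and>
                line_group s L i \<cong>
                  (add_monoid (ring_of_type_algebra :: 'k alg_closure ring))\<lparr>carrier := H\<rparr>) \<and>
           comm_group (line_group s L i)) \<and>
         (let L' = extend_scalars \<circ> L in
           (\<forall>i<s.
             (\<exists>H. subgroup H (add_monoid (ring_of_type_algebra :: 'k alg_closure ring)) \<and>
                  line_group s L' i \<cong>
                    (add_monoid (ring_of_type_algebra :: 'k alg_closure ring))\<lparr>carrier := H\<rparr>) \<and>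
             comm_group (line_group s L' i)) \<and>
           {Z \<in> groupoid_orbit s L' ` config_points s L'. card Z = s} =
             {proj_points T \<inter> config_points s L'} \<and>
           (\<forall>i<s. \<forall>j<s. \<forall>h \<in> groupoid_hom s L' i j.
              faithful_action (line_group s L' i) (proj_points (L' j)) (line_action L' i j h) \<and>
              (\<forall>p \<in> proj_points (L' j) - proj_points T.
                 stabilizer (line_group s L' i) (line_action L' i j h) p
                   = {\<one>\<^bsub>line_group s L' i\<^esub>})) \<and>
           (\<forall>p \<in> config_points s L' - proj_points T.
            \<forall>q \<in> config_points s L' - proj_points T.
              (\<forall>i<s. {..<s} \<times> carrier (line_group s L' i) \<approx> groupoid_orbit s L' p) \<and>
              groupoid_orbit s L' p \<approx> groupoid_orbit s L' q \<and>
              {..<s} \<prec> groupoid_orbit s L' q \<and>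
              projectively_equivalent (groupoid_orbit s L' p) (groupoid_orbit s L' q)) \<and>
           (\<forall>p \<in> config_points s L' - proj_points T.
              infinite (groupoid_orbit s L' p) \<longleftrightarrow> CHAR('k) = 0)) \<and>
         (\<forall>T\<^sub>0 :: ('k ^ 4) set. proj_line T\<^sub>0 \<and> extend_scalars T\<^sub>0 = T \<longrightarrow>
           {Z \<in> groupoid_orbit s L ` config_points s L. card Z = s} =
             {proj_points T\<^sub>0 \<inter> config_points s L} \<and>
           (\<forall>i<s. \<forall>j<s. \<forall>h \<in> groupoid_hom s L i j.
              faithful_action (line_group s L i) (proj_points (L j)) (line_action L i j h) \<and>
              (\<forall>p \<in> proj_points (L j) - proj_points T\<^sub>0.
                 stabilizer (line_group s L i) (line_action L i j h) p
                   = {\<one>\<^bsub>line_group s L i\<^esub>})) \<and>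
           (\<forall>p \<in> config_points s L - proj_points T\<^sub>0.
            \<forall>q \<in> config_points s L - proj_points T\<^sub>0.
              (\<forall>i<s. {..<s} \<times> carrier (line_group s L i) \<approx> groupoid_orbit s L p) \<and>
              groupoid_orbit s L p \<approx> groupoid_orbit s L q \<and>
              {..<s} \<prec> groupoid_orbit s L q \<and>
              projectively_equivalent (groupoid_orbit s L p) (groupoid_orbit s L q)) \<and>
           (\<forall>p \<in> config_points s L - proj_points T\<^sub>0.
              infinite (groupoid_orbit s L p) \<longleftrightarrow> CHAR('k) = 0))"
proof -
  let ?L' = "extend_scalars \<circ> L"
  have skew': "skew_lines s ?L'" by (rule skew_lines_extend_scalars[OF assms(2)])
  obtain C :: "'k alg_closure ^ 4 ^ 4" and t u where C: "\<forall>v. C *v v = 0 \<longrightarrow> v = 0" and t: "inj_on t {..<s}"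
    and T: "T = {v. (C *v v) $ 3 = 0 \<and> (C *v v) $ 4 = 0}"
    and mem: "\<forall>i<s. \<forall>v. v \<in> ?L' i \<longleftrightarrow> (C *v v) $ 4 = t i * (C *v v) $ 3 \<and>
      (C *v v) $ 2 = t i * (C *v v) $ 1 + u i * (C *v v) $ 3"
    and nq: "\<not> (\<exists>\<alpha> \<beta> \<gamma>. \<forall>i<s. u i = \<alpha> + \<beta> * t i + \<gamma> * (t i)\<^sup>2)"
    using double_transversal_coordinates[OF skew' assms(3)] .
  note mem = mem[rule_format]
  have line: "proj_line (L i)" if "i < s" for i using assms(2) that by (simp add: skew_lines_def)
  have line': "proj_line (?L' i)" if "i < s" for i using skew' that by (simp add: skew_lines_def)
  have mem_L: "x \<in> L i \<longleftrightarrow> extend_vec x \<in> ?L' i" if "i < s" for i x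
    using line[OF that] by (simp add: extend_vec_mem_iff proj_line_def)
  \<comment> \<open>Both interpretations share \<open>C\<close>, \<open>t\<close> and
    \<open>u\<close>; only the embedding differs.\<close>
  interpret K: line_coordinates s L to_ac C t u "\<lambda>x. C *v (\<chi> i. to_ac (x $ i))"
  proof unfold_locales
    show "v = 0" if "C *v v = 0" for v using C that by blast
    show "4 \<le> s" by (rule assms(1))
    show "inj_on t {..<s}" by (rule t)
    show "proj_line (L i)" if "i < s" for i by (rule line[OF that])
    show "x \<in> L i \<longleftrightarrow> (C *v (\<chi> i. to_ac (x $ i))) $ 4 = t i * (C *v (\<chi> i. to_ac (x $ i))) $ 3 \<and>
      (C *v (\<chi> i. to_ac (x $ i))) $ 2 = t i * (C *v (\<chi> i. to_ac (x $ i))) $ 1 +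
        u i * (C *v (\<chi> i. to_ac (x $ i))) $ 3" if "i < s" for i x
      unfolding mem_L[OF that] mem[OF that] extend_vec_def by (rule refl)
  qed (use nq in simp_all)
  interpret F: line_coordinates s ?L' "\<lambda>a. a" C t u "\<lambda>x. C *v (\<chi> i. x $ i)"
  proof unfold_locales
    show "v = 0" if "C *v v = 0" for v using C that by blast
    show "4 \<le> s" by (rule assms(1))
    show "inj_on t {..<s}" by (rule t)
    show "proj_line (?L' i)" if "i < s" for i by (rule line'[OF that])
    show "x \<in> ?L' i \<longleftrightarrow> (C *v (\<chi> i. x $ i)) $ 4 = t i * (C *v (\<chi> i. x $ i)) $ 3 \<and>
      (C *v (\<chi> i. x $ i)) $ 2 = t i * (C *v (\<chi> i. x $ i)) $ 1 + u i * (C *v (\<chi> i. x $ i)) $ 3"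
      if "i < s" for i x
      unfolding mem[OF that] vec_lambda_eta by (rule refl)
  qed (use nq in simp_all)
  have axis_F: "F.axis_space = T" unfolding F.axis_space_def T by simp
  have meet: "\<exists>p. p \<in> proj_points (?L' i) \<and> p \<in> proj_points T" if "i < s" for i
    using assms(3) that unfolding double_transversal_def transversal_def by blast
  note block_F = F.orbits_off_axis[unfolded axis_F, OF meet]
  have block_K: "{Z \<in> groupoid_orbit s L ` config_points s L. card Z = s} =
             {proj_points T\<^sub>0 \<inter> config_points s L} \<and>
           (\<forall>i<s. \<forall>j<s. \<forall>h \<in> groupoid_hom s L i j.
              faithful_action (line_group s L i) (proj_points (L j)) (line_action L i j h) \<and>
              (\<forall>p \<in> proj_points (L j) - proj_points T\<^sub>0.
                 stabilizer (line_group s L i) (line_action L i j h) p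
                   = {\<one>\<^bsub>line_group s L i\<^esub>})) \<and>
           (\<forall>p \<in> config_points s L - proj_points T\<^sub>0.
            \<forall>q \<in> config_points s L - proj_points T\<^sub>0.
              (\<forall>i<s. {..<s} \<times> carrier (line_group s L i) \<approx> groupoid_orbit s L p) \<and>
              groupoid_orbit s L p \<approx> groupoid_orbit s L q \<and>
              {..<s} \<prec> groupoid_orbit s L q \<and>
              projectively_equivalent (groupoid_orbit s L p) (groupoid_orbit s L q)) \<and>
           (\<forall>p \<in> config_points s L - proj_points T\<^sub>0.
              infinite (groupoid_orbit s L p) \<longleftrightarrow> CHAR('k alg_closure) = 0)"
    if T0: "proj_line T\<^sub>0 \<and> extend_scalars T\<^sub>0 = T" for T\<^sub>0
  proof -
    note T0 = conjunct1[OF T0] conjunct2[OF T0]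
    have sub0: "vec.subspace T\<^sub>0" using T0(1) by (simp add: proj_line_def)
    have axis_K: "K.axis_space = T\<^sub>0"
      unfolding K.axis_space_def extend_vec_def[symmetric]
      using extend_vec_mem_iff[OF sub0] T by (auto simp: T0(2))
    \<comment> \<open>Rational lines that do not meet over K stay skew over the closure, where
      \<open>L i\<close> and T do meet.\<close>
    have "\<exists>p. p \<in> proj_points (L i) \<and> p \<in> proj_points T\<^sub>0" if i: "i < s" for i
    proof (rule ccontr)
      have sub: "vec.subspace (L i)" using line[OF i] by (simp add: proj_line_def)
      assume "\<nexists>p. p \<in> proj_points (L i) \<and> p \<in> proj_points T\<^sub>0"
      then have "L i \<inter> T\<^sub>0 \<subseteq> {0}" using proj_points_Int_empty_iff[OF sub sub0] by blast
      then have "?L' i \<inter> T \<subseteq> {0}"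
        using extend_scalars_disjoint[OF line[OF i] T0(1)] by (simp add: T0(2))
      moreover have "vec.subspace (?L' i)" "vec.subspace T"
        using line'[OF i] proj_line_extend_scalars[OF T0(1)] by (simp_all add: proj_line_def T0(2))
      ultimately show False using meet[OF i] proj_points_Int_empty_iff[of "?L' i" T] by blast
    qed
    then show ?thesis by (rule K.orbits_off_axis[unfolded axis_K])
  qed
  show ?thesis
    unfolding Let_def
    by (rule conjI, rule K.line_group_additive, rule conjI, rule conjI, rule F.line_group_additive,
        rule block_F[unfolded CHAR_alg_closure], assumption, intro allI impI, rule block_K[unfolded CHAR_alg_closure])
qed

end
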